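(* Within the pseudovariety $\mathsf M$ of all finite monoids, each of the sets of pseudoidentities $\Sigma=\{x^{\omega+1}=x^\omega,\ (xy)^\omega=(yx)^\omega\}$ and $\Gamma=\{(xy)^\omega x=(xy)^\omega,\ (xy)^\omega=y(xy)^\omega\}$ is h-strong.
   Context: $\mathsf M$ is the pseudovariety of finite monoids (signature: multiplication and $1$); $\Omega_A\mathsf M$ is the free profinite monoid on a finite set $A$. In a profinite monoid $x^\omega=\lim x^{n!}$ and $x^{\omega+1}=x^\omega x$. An $\mathsf M$-pseudoidentity is $u=v$ with $u,v\in\Omega_B\mathsf M$, $B$ finite; it holds in a finite monoid $T$ if both sides agree under every continuous homomorphism $\Omega_B\mathsf M\to T$; $[\![\Sigma]\!]$ is the class of finite monoids satisfying $\Sigma$. Provability: for finite $A$, $\Sigma_0\subseteq\Omega_A\mathsf M\times\Omega_A\mathsf M$ is the set of pairs $(\mathbf t(\varphi(u),w_1,\dots,w_n),\mathbf t(\varphi(v),w_1,\dots,w_n))$ with $u=v$ or $v=u$ in $\Sigma$ ($u,v\in\Omega_B\mathsf M$), $\varphi:\Omega_B\mathsf M\to\Omega_A\mathsf M$ a continuous homomorphism, $\mathbf t$ a monoid term, $w_i\in\Omega_A\mathsf M$; $\Sigma_{2\alpha+1}$ is the transitive closure of $\Sigma_{2\alpha}$, $\Sigma_{2\alpha+2}$ the topological closure of $\Sigma_{2\alpha+1}$, unions at limit ordinals; $u=v$ is provable from $\Sigma$ if $(u,v)\in\bigcup_\alpha\Sigma_\alpha$. A set $\Sigma$ is h-strong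 within $\mathsf M$ if every $\mathsf M$-pseudoidentity valid in $[\![\Sigma]\!]$ is provable from $\Sigma$. *)

theory Defs
  imports "HOL-Algebra.Group" "HOL-Library.FuncSet"
begin

text \<open>Finite monoids are represented (up to isomorphism) by HOL-Algebra monoids
whose carrier is a finite set of naturals.  Homomorphisms are monoid
homomorphisms (preserving multiplication and the unit).\<close>

definition fin_mon :: "nat monoid \<Rightarrow> bool" where
  "fin_mon T \<longleftrightarrow> monoid T \<and> finite (carrier T)"

definition mon_hom :: "nat monoid \<Rightarrow> nat monoid \<Rightarrow> (nat \<Rightarrow> nat) set" where
  "mon_hom S T = {h. h \<in> hom S T \<and> h \<one>\<^bsub>S\<^esub> = \<one>\<^bsub>T\<^esub>}"

section \<open>The free profinite monoid as the monoid of A-ary implicit operations on M\<close>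

type_synonym 'a iop = "nat monoid \<Rightarrow> ('a \<Rightarrow> nat) \<Rightarrow> nat"

definition admissible :: "'a set \<Rightarrow> nat monoid \<Rightarrow> ('a \<Rightarrow> nat) \<Rightarrow> bool" where
  "admissible A T e \<longleftrightarrow> fin_mon T \<and> e \<in> A \<rightarrow>\<^sub>E carrier T"

definition implicit_op :: "'a set \<Rightarrow> 'a iop \<Rightarrow> bool" where
  "implicit_op A \<pi> \<longleftrightarrow>
     (\<forall>T e. \<not> admissible A T e \<longrightarrow> \<pi> T e = undefined) \<and>
     (\<forall>T e. admissible A T e \<longrightarrow> \<pi> T e \<in> carrier T) \<and>
     (\<forall>S T h e. admissible A S e \<and> fin_mon T \<and> h \<in> mon_hom S T \<longrightarrow>
                 h (\<pi> S e) = \<pi> T (\<lambda>a\<in>A. h (e a)))"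

definition pOmega :: "'a set \<Rightarrow> 'a iop set" where
  "pOmega A = {\<pi>. implicit_op A \<pi>}"

definition pmult :: "'a set \<Rightarrow> 'a iop \<Rightarrow> 'a iop \<Rightarrow> 'a iop" where
  "pmult A u v = (\<lambda>T e. if admissible A T e then u T e \<otimes>\<^bsub>T\<^esub> v T e else undefined)"

definition pone :: "'a set \<Rightarrow> 'a iop" where
  "pone A = (\<lambda>T e. if admissible A T e then \<one>\<^bsub>T\<^esub> else undefined)"

definition pgen :: "'a set \<Rightarrow> 'a \<Rightarrow> 'a iop" where
  "pgen A a = (\<lambda>T e. if admissible A T e then e a else undefined)"

primrec ppow :: "'a set \<Rightarrow> 'a iop \<Rightarrow> nat \<Rightarrow> 'a iop" where
  "ppow A u 0 = pone A"
| "ppow A u (Suc n) = pmult A (ppow A u n) u"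

section \<open>Topology (pointwise topology: product of discrete spaces)\<close>

text \<open>Basic neighbourhoods of \<open>u\<close> are given by finite sets \<open>F\<close> of evaluation points.\<close>
definition agree :: "(nat monoid \<times> ('a \<Rightarrow> nat)) set \<Rightarrow> 'a iop \<Rightarrow> 'a iop \<Rightarrow> bool" where
  "agree F u v \<longleftrightarrow> (\<forall>(T, e)\<in>F. u T e = v T e)"

definition pconv :: "'a set \<Rightarrow> (nat \<Rightarrow> 'a iop) \<Rightarrow> 'a iop \<Rightarrow> bool" where
  "pconv A s w \<longleftrightarrow> (\<forall>F. finite F \<longrightarrow> (\<forall>\<^sub>F n in sequentially. agree F (s n) w))"

definition pomega :: "'a set \<Rightarrow> 'a iop \<Rightarrow> 'a iop" where
  "pomega A x = (THE w. w \<in> pOmega A \<and> pconv A (\<lambda>n. ppow A x (fact n)) w)"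

definition pair_closure :: "'a set \<Rightarrow> ('a iop \<times> 'a iop) set \<Rightarrow> ('a iop \<times> 'a iop) set" where
  "pair_closure A R = {(u, v). u \<in> pOmega A \<and> v \<in> pOmega A \<and>
      (\<forall>F. finite F \<longrightarrow> (\<exists>(u', v')\<in>R. agree F u u' \<and> agree F v v'))}"

definition cont_hom :: "'b set \<Rightarrow> 'a set \<Rightarrow> ('b iop \<Rightarrow> 'a iop) \<Rightarrow> bool" where
  "cont_hom B A \<phi> \<longleftrightarrow>
     \<phi> \<in> pOmega B \<rightarrow> pOmega A \<and>
     (\<forall>u\<in>pOmega B. \<forall>v\<in>pOmega B. \<phi> (pmult B u v) = pmult A (\<phi> u) (\<phi> v)) \<and>
     \<phi> (pone B) = pone A \<and>
     (\<forall>u\<in>pOmega B. \<forall>F. finite F \<longrightarrow>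
        (\<exists>G. finite G \<and> (\<forall>w\<in>pOmega B. agree G u w \<longrightarrow> agree F (\<phi> u) (\<phi> w))))"

definition cont_hom_fin :: "'b set \<Rightarrow> nat monoid \<Rightarrow> ('b iop \<Rightarrow> nat) \<Rightarrow> bool" where
  "cont_hom_fin B T h \<longleftrightarrow>
     h \<in> pOmega B \<rightarrow> carrier T \<and>
     (\<forall>u\<in>pOmega B. \<forall>v\<in>pOmega B. h (pmult B u v) = h u \<otimes>\<^bsub>T\<^esub> h v) \<and>
     h (pone B) = \<one>\<^bsub>T\<^esub> \<and>
     (\<forall>u\<in>pOmega B. \<exists>G. finite G \<and> (\<forall>w\<in>pOmega B. agree G u w \<longrightarrow> h w = h u))"

text \<open>A pseudoidentity \<open>u = v\<close> with \<open>u, v \<in> \<Omega>_B M\<close> is a triple \<open>(B, u, v)\<close>.\<close>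
type_synonym pseudoid = "nat set \<times> nat iop \<times> nat iop"

definition holds_in :: "nat monoid \<Rightarrow> 'b set \<Rightarrow> 'b iop \<Rightarrow> 'b iop \<Rightarrow> bool" where
  "holds_in T B u v \<longleftrightarrow> (\<forall>h. cont_hom_fin B T h \<longrightarrow> h u = h v)"

definition models :: "pseudoid set \<Rightarrow> nat monoid \<Rightarrow> bool" where
  "models \<Sigma> T \<longleftrightarrow> fin_mon T \<and> (\<forall>(B, u, v)\<in>\<Sigma>. holds_in T B u v)"

datatype mterm = MVar nat | MOne | MMul mterm mterm

fun meval :: "'a set \<Rightarrow> mterm \<Rightarrow> (nat \<Rightarrow> 'a iop) \<Rightarrow> 'a iop" where
  "meval A (MVar i) w = w i"
| "meval A MOne w = pone A"
| "meval A (MMul s t) w = pmult A (meval A s w) (meval A t w)"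

text \<open>\<open>\<Sigma>_0\<close>: variable 0 of the term is the slot for \<open>\<phi>(u)\<close>, the others are the \<open>w_i\<close>.\<close>
definition Sigma0 :: "'a set \<Rightarrow> pseudoid set \<Rightarrow> ('a iop \<times> 'a iop) set" where
  "Sigma0 A \<Sigma> = {(meval A t (w(0 := \<phi> u)), meval A t (w(0 := \<phi> v))) | B u v \<phi> t w.
      ((B, u, v) \<in> \<Sigma> \<or> (B, v, u) \<in> \<Sigma>) \<and> cont_hom B A \<phi> \<and> (\<forall>i. w i \<in> pOmega A)}"

text \<open>The union of the transfinite chain \<open>\<Sigma>_\<alpha>\<close> is the least set containing \<open>\<Sigma>_0\<close>
closed under transitive and topological closure.\<close>
definition provable :: "'a set \<Rightarrow> pseudoid set \<Rightarrow> ('a iop \<times> 'a iop) set" where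
  "provable A \<Sigma> = \<Inter>{R. Sigma0 A \<Sigma> \<subseteq> R \<and> trans R \<and> pair_closure A R \<subseteq> R}"

definition h_strong_on :: "'a set \<Rightarrow> pseudoid set \<Rightarrow> bool" where
  "h_strong_on A \<Sigma> \<longleftrightarrow>
     (\<forall>u\<in>pOmega A. \<forall>v\<in>pOmega A.
        (\<forall>T. models \<Sigma> T \<longrightarrow> holds_in T A u v) \<longrightarrow> (u, v) \<in> provable A \<Sigma>)"

section \<open>The sets \<open>\<Sigma>\<close> and \<open>\<Gamma>\<close>; x = generator 0, y = generator 1\<close>

definition Sigma_ps :: "pseudoid set" where
  "Sigma_ps =
    {({0}, pmult {0} (pomega {0} (pgen {0} 0)) (pgen {0} 0), pomega {0} (pgen {0} 0)),
     ({0,1}, pomega {0,1} (pmult {0,1} (pgen {0,1} 0) (pgen {0,1} 1)),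
             pomega {0,1} (pmult {0,1} (pgen {0,1} 1) (pgen {0,1} 0)))}"

definition Gamma_ps :: "pseudoid set" where
  "Gamma_ps =
    {({0,1}, pmult {0,1} (pomega {0,1} (pmult {0,1} (pgen {0,1} 0) (pgen {0,1} 1))) (pgen {0,1} 0),
             pomega {0,1} (pmult {0,1} (pgen {0,1} 0) (pgen {0,1} 1))),
     ({0,1}, pomega {0,1} (pmult {0,1} (pgen {0,1} 0) (pgen {0,1} 1)),
             pmult {0,1} (pgen {0,1} 1) (pomega {0,1} (pmult {0,1} (pgen {0,1} 0) (pgen {0,1} 1))))}"

end

theory Submission
  imports Defs "HOL-Library.Sublist"
begin

text \<open>
  Provability is a closed congruence on the monoid of implicit operations, and \<open>\<Sigma>\<close> proves
  \<open>\<Gamma>\<close>, so it suffices to work with a closed congruence satisfying \<open>\<Gamma>\<close>.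
  For such a congruence the power \<open>z\<^sup>\<omega>\<close> absorbs every letter of \<open>z\<close> on both sides
  and therefore depends only on the content of \<open>z\<close>. By induction on the content, repeatedly
  cutting at first occurrences of letters either stops, and an element is a product of elements of smaller
  content and letters, or it goes on forever, and then a pigeonhole argument at each finite set of evaluation
  points identifies the element, in the limit, with such a power. So every element is congruent to a finite
  product of letters and of powers \<open>(b\<^sub>1 \<dots> b\<^sub>r)\<^sup>\<omega>\<close>, whose subwords form the product of the
  languages \<open>{\<epsilon>, a}\<close> and \<open>B\<^sup>*\<close>; comparing first factors shows that the language
  determines the product up to the congruence. Conversely, the set of subwords is recognized by finite
  ordered monoids in which the unit is least, and these satisfy both \<open>\<Sigma>\<close> and \<open>\<Gamma>\<close>.
\<close>

section \<open>The monoid of implicit operations\<close>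

text \<open>The elements are implicit operations, not words, so a letter cannot be located in them
  directly. Two devices replace this. By density, an implicit operation agrees with a word at any
  finite set of evaluation points. And a property of words that a finite monoid recognizes (short
  subwords, the two factors around a first occurrence) can be read off from the value of the
  operation in that monoid. First occurrences are the right place to cut because the factor in front
  misses a letter and thus falls under the induction on the content. If the cutting never stops, the
  remainders need not converge in a useful way; hence the pigeonhole argument at one finite set of
  points at a time, with the closedness of the congruence supplying the limit. Both systems define
  the finite J-trivial monoids, and the ordered monoids used for testing subwords are models of
  both, so that a single implication, from equal subwords to congruence, serves the two
  systems.\<close>

lemma fin_mon_monoid: "fin_mon T \<Longrightarrow> monoid T"
  by (simp add: fin_mon_def)

lemma admissible_monoid: "admissible A T e \<Longrightarrow> monoid T"
  by (simp add: admissible_def fin_mon_def)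

lemma admissible_carrier: "admissible A T e \<Longrightarrow> a \<in> A \<Longrightarrow> e a \<in> carrier T"
  by (auto simp: admissible_def)

lemma mon_hom_mult:
  "h \<in> mon_hom S T \<Longrightarrow> x \<in> carrier S \<Longrightarrow> y \<in> carrier S \<Longrightarrow>
    h (x \<otimes>\<^bsub>S\<^esub> y) = h x \<otimes>\<^bsub>T\<^esub> h y"
  by (auto simp: mon_hom_def hom_def)

lemma mon_hom_one: "h \<in> mon_hom S T \<Longrightarrow> h \<one>\<^bsub>S\<^esub> = \<one>\<^bsub>T\<^esub>"
  by (auto simp: mon_hom_def)

lemma admissible_hom:
  assumes "admissible A S e" "fin_mon T" "h \<in> mon_hom S T"
  shows "admissible A T (\<lambda>a\<in>A. h (e a))"
  using assms by (auto simp: admissible_def mon_hom_def hom_def)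

lemma pOmegaI:
  assumes "\<And>T e. \<not> admissible A T e \<Longrightarrow> u T e = undefined"
    and "\<And>T e. admissible A T e \<Longrightarrow> u T e \<in> carrier T"
    and "\<And>S T h e. admissible A S e \<Longrightarrow> fin_mon T \<Longrightarrow> h \<in> mon_hom S T \<Longrightarrow>
      admissible A T (\<lambda>a\<in>A. h (e a)) \<Longrightarrow> h (u S e) = u T (\<lambda>a\<in>A. h (e a))"
  shows "u \<in> pOmega A"
  unfolding pOmega_def implicit_op_def using assms admissible_hom by blast

lemma pOmega_carrier: "u \<in> pOmega A \<Longrightarrow> admissible A T e \<Longrightarrow> u T e \<in> carrier T"
  by (auto simp: pOmega_def implicit_op_def)

lemma pOmega_undefined: "u \<in> pOmega A \<Longrightarrow> \<not> admissible A T e \<Longrightarrow> u T e = undefined"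
  by (auto simp: pOmega_def implicit_op_def)

lemma pOmega_hom:
  "u \<in> pOmega A \<Longrightarrow> admissible A S e \<Longrightarrow> fin_mon T \<Longrightarrow> h \<in> mon_hom S T \<Longrightarrow>
    h (u S e) = u T (\<lambda>a\<in>A. h (e a))"
  by (auto simp: pOmega_def implicit_op_def)

lemma pOmega_eqI:
  assumes "u \<in> pOmega A" "v \<in> pOmega A" "\<And>T e. admissible A T e \<Longrightarrow> u T e = v T e"
  shows "u = v"
proof (intro ext)
  show "u T e = v T e" for T e
    using assms by (cases "admissible A T e") (simp_all add: pOmega_undefined[where A = A])
qed

lemma pmult_eval: "admissible A T e \<Longrightarrow> pmult A u v T e = u T e \<otimes>\<^bsub>T\<^esub> v T e"
  by (simp add: pmult_def)

lemma pone_eval: "admissible A T e \<Longrightarrow> pone A T e = \<one>\<^bsub>T\<^esub>"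
  by (simp add: pone_def)

lemma pgen_eval: "admissible A T e \<Longrightarrow> pgen A a T e = e a"
  by (simp add: pgen_def)

lemma pmult_closed [simp, intro]:
  assumes "u \<in> pOmega A" "v \<in> pOmega A"
  shows "pmult A u v \<in> pOmega A"
proof (rule pOmegaI)
  fix T :: "nat monoid" and e
  show "\<not> admissible A T e \<Longrightarrow> pmult A u v T e = undefined"
    by (simp add: pmult_def)
  show "admissible A T e \<Longrightarrow> pmult A u v T e \<in> carrier T"
    using assms by (simp add: pmult_eval monoid.m_closed admissible_monoid pOmega_carrier)
next
  fix S T :: "nat monoid" and h e
  assume *: "admissible A S e" "fin_mon T" "h \<in> mon_hom S T" "admissible A T (\<lambda>a\<in>A. h (e a))"
  show "h (pmult A u v S e) = pmult A u v T (\<lambda>a\<in>A. h (e a))"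
    using * assms pOmega_hom[OF assms(1) *(1-3)] pOmega_hom[OF assms(2) *(1-3)]
    by (simp add: pmult_eval mon_hom_mult pOmega_carrier)
qed

lemma pone_closed [simp, intro]: "pone A \<in> pOmega A"
  by (rule pOmegaI)
    (auto simp: pone_def mon_hom_one monoid.one_closed admissible_monoid)

lemma pgen_closed [simp, intro]: "a \<in> A \<Longrightarrow> pgen A a \<in> pOmega A"
  by (rule pOmegaI) (auto simp: pgen_def admissible_carrier)

lemma pmult_assoc:
  assumes "u \<in> pOmega A" "v \<in> pOmega A" "w \<in> pOmega A"
  shows "pmult A (pmult A u v) w = pmult A u (pmult A v w)"
  using assms
  by (intro pOmega_eqI[of _ A])
    (auto simp: pmult_eval monoid.m_assoc admissible_monoid pOmega_carrier)

lemma pmult_pone_left [simp]: "u \<in> pOmega A \<Longrightarrow> pmult A (pone A) u = u"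
  by (intro pOmega_eqI[of _ A])
    (auto simp: pmult_eval pone_eval admissible_monoid monoid.l_one pOmega_carrier)

lemma pmult_pone_right [simp]: "u \<in> pOmega A \<Longrightarrow> pmult A u (pone A) = u"
  by (intro pOmega_eqI[of _ A])
    (auto simp: pmult_eval pone_eval admissible_monoid monoid.r_one pOmega_carrier)

lemma ppow_closed [simp, intro]: "u \<in> pOmega A \<Longrightarrow> ppow A u n \<in> pOmega A"
  by (induction n) auto

lemma ppow_eval: "admissible A T e \<Longrightarrow> ppow A u n T e = u T e [^]\<^bsub>T\<^esub> n"
  by (induction n) (auto simp: pone_eval pmult_eval nat_pow_def)

lemma agree_refl [simp]: "agree F u u"
  by (auto simp: agree_def)

lemma agree_sym: "agree F u v \<Longrightarrow> agree F v u"
  by (auto simp: agree_def)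

lemma agree_subset: "agree F u v \<Longrightarrow> G \<subseteq> F \<Longrightarrow> agree G u v"
  by (auto simp: agree_def)

lemma agreeI_admissible:
  assumes "u \<in> pOmega A" "v \<in> pOmega A"
    and "\<And>T e. (T, e) \<in> F \<Longrightarrow> admissible A T e \<Longrightarrow> u T e = v T e"
  shows "agree F u v"
proof -
  have "u T e = v T e" if "(T, e) \<in> F" for T e
    using assms that by (cases "admissible A T e") (simp_all add: pOmega_undefined[where A = A])
  then show ?thesis by (auto simp: agree_def)
qed

lemma agree_pmult: "agree F u u' \<Longrightarrow> agree F v v' \<Longrightarrow> agree F (pmult A u v) (pmult A u' v')"
  by (fastforce simp: agree_def pmult_def)

section \<open>Factorial powers and the omega power\<close>

text \<open>Among the powers of \<open>x\<close> with exponents from 0 to N, the order of the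
  monoid, two coincide, at i < j. The index i and the period p = j - i are at most N, so every n!
  with n >= N lies beyond the index and is a multiple of p. Hence these powers coincide and are
  idempotent.\<close>

lemma finite_monoid_power_fact:
  fixes T (structure)
  assumes "monoid T" "finite (carrier T)" "x \<in> carrier T" "card (carrier T) \<le> n"
  shows "x [^] (fact n :: nat) = x [^] (fact (card (carrier T)) :: nat)"
    and "x [^] (fact n :: nat) \<otimes> x [^] (fact n :: nat) = x [^] (fact n :: nat)"
proof -
  interpret monoid T by fact
  define N where "N = card (carrier T)"
  have "(\<lambda>i. x [^] i) ` {..N} \<subseteq> carrier T"
    using assms by auto
  then have "card ((\<lambda>i. x [^] i) ` {..N}) < card {..N}"
    using card_mono[OF assms(2), of "(\<lambda>i. x [^] i) ` {..N}"] unfolding N_def by simp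
  then have "\<not> inj_on (\<lambda>i::nat. x [^] i) {..N}"
    using pigeonhole by blast
  then obtain i j :: nat where ij: "i < j" "j \<le> N" "x [^] i = x [^] j"
    unfolding inj_on_def by (metis atMost_iff linorder_neqE_nat)
  define p where "p = j - i"
  have step: "x [^] (m + p) = x [^] m" if "m \<ge> i" for m
  proof -
    have "x [^] (m + p) = x [^] (m - i) \<otimes> x [^] j"
      using ij that assms(3) by (simp add: nat_pow_mult p_def)
    also have "\<dots> = x [^] m"
      using ij(3)[symmetric] that assms(3) by (simp add: nat_pow_mult)
    finally show ?thesis .
  qed
  have steps: "x [^] (m + p * k) = x [^] m" if "m \<ge> i" for m k
  proof (induction k)
    case (Suc k)
    have "m + p * Suc k = (m + p * k) + p" by simp
    then show ?case using step[of "m + p * k"] that Suc by (simp only:)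
  qed simp
  have p: "p dvd fact m" if "N \<le> m" for m
    using ij that by (intro dvd_fact) (auto simp: p_def)
  have ge: "i \<le> fact m" if "N \<le> m" for m
    using ij that fact_ge_self[of m] by linarith
  have n: "N \<le> n" using assms N_def by simp
  have "p dvd fact n - fact N" using p[OF n] p[of N] by simp
  then obtain k where k: "fact n - fact N = p * k" by blast
  have "(fact n :: nat) = fact N + p * k"
    using k fact_mono_nat[OF n] by linarith
  then show "x [^] (fact n :: nat) = x [^] (fact (card (carrier T)) :: nat)"
    using steps[OF ge[of N]] unfolding N_def[symmetric] by simp
  obtain l where l: "fact n = p * l" using p[OF n] by blast
  show "x [^] (fact n :: nat) \<otimes> x [^] (fact n :: nat) = x [^] (fact n :: nat)"
    using steps[OF ge[OF n], of l] l assms(3) by (simp add: nat_pow_mult)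
qed

text \<open>In each \<open>T\<close> the factorial powers are constant from n = card (carrier T) on,
  so the limit can be written down explicitly. It is unique since two limits agree at each single
  point, and this is what makes the \<open>THE\<close> meaningful.\<close>

lemma pomega_properties:
  fixes A :: "'a set"
  assumes x: "x \<in> pOmega A"
  shows pomega_closed [simp, intro]: "pomega A x \<in> pOmega A"
    and pomega_conv: "pconv A (\<lambda>n. ppow A x (fact n)) (pomega A x)"
proof -
  define w where "w = (\<lambda>T e. if admissible A T e
      then x T e [^]\<^bsub>T\<^esub> (fact (card (carrier T)) :: nat) else undefined)"
  have ev: "ppow A x (fact n) T e = w T e"
    if "card (carrier T) \<le> n" "admissible A T e" for n T e
    using that x finite_monoid_power_fact(1)[of T "x T e" n]
    by (auto simp: ppow_eval w_def admissible_def fin_mon_def pOmega_carrier)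
  have w: "w \<in> pOmega A"
  proof (rule pOmegaI)
    fix T :: "nat monoid" and e
    show "\<not> admissible A T e \<Longrightarrow> w T e = undefined"
      by (simp add: w_def)
    show "admissible A T e \<Longrightarrow> w T e \<in> carrier T"
      using ev[of T _ e] pOmega_carrier[OF ppow_closed[OF x]] by (metis order_refl)
  next
    fix S T :: "nat monoid" and h e
    assume *: "admissible A S e" "fin_mon T" "h \<in> mon_hom S T"
      "admissible A T (\<lambda>a\<in>A. h (e a))"
    \<comment> \<open>An exponent at which the powers have stabilized in both \<open>S\<close> and
      \<open>T\<close>, so that naturality of one fixed power can be used.\<close>
    define n where "n = card (carrier S) + card (carrier T)"
    have "h (w S e) = h (ppow A x (fact n) S e)"
      using ev[of S n e] * by (simp add: n_def)
    also have "\<dots> = ppow A x (fact n) T (\<lambda>a\<in>A. h (e a))"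
      using pOmega_hom[OF ppow_closed[OF x] *(1-3)] .
    also have "\<dots> = w T (\<lambda>a\<in>A. h (e a))"
      using ev[of T n] * by (simp add: n_def)
    finally show "h (w S e) = w T (\<lambda>a\<in>A. h (e a))" .
  qed
  have c: "pconv A (\<lambda>n. ppow A x (fact n)) w"
    unfolding pconv_def
  proof (intro allI impI)
    fix F :: "(nat monoid \<times> ('a \<Rightarrow> nat)) set"
    assume "finite F"
    then obtain N where N: "\<And>T e. (T, e) \<in> F \<Longrightarrow> card (carrier T) \<le> N"
      using finite_nat_set_iff_bounded_le[of "(\<lambda>(T, e). card (carrier T)) ` F"] by fastforce
    have "agree F (ppow A x (fact n)) w" if "N \<le> n" for n
    proof (rule agreeI_admissible[OF ppow_closed[OF x] w])
      fix T e assume *: "(T, e) \<in> F" "admissible A T e"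
      show "ppow A x (fact n) T e = w T e"
        by (rule ev[OF order_trans[OF N[OF *(1)] that] *(2)])
    qed
    then show "\<forall>\<^sub>F n in sequentially. agree F (ppow A x (fact n)) w"
      by (auto simp: eventually_sequentially)
  qed
  have "pomega A x = w"
    unfolding pomega_def
  proof (rule the_equality)
    show "w \<in> pOmega A \<and> pconv A (\<lambda>n. ppow A x (fact n)) w"
      using w c by simp
  next
    fix v assume v: "v \<in> pOmega A \<and> pconv A (\<lambda>n. ppow A x (fact n)) v"
    show "v = w"
    proof (intro ext)
      fix T e
      have "\<forall>\<^sub>F n in sequentially. agree {(T, e)} (ppow A x (fact n)) v
          \<and> agree {(T, e)} (ppow A x (fact n)) w"
        using v c unfolding pconv_def by (intro eventually_conj) auto
      then obtain n where "agree {(T, e)} (ppow A x (fact n)) v"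
          "agree {(T, e)} (ppow A x (fact n)) w"
        by (auto simp: eventually_sequentially)
      then show "v T e = w T e" by (simp add: agree_def)
    qed
  qed
  then show "pomega A x \<in> pOmega A" "pconv A (\<lambda>n. ppow A x (fact n)) (pomega A x)"
    using w c by auto
qed

lemma pomega_agree:
  assumes "x \<in> pOmega A" "finite F"
  shows "\<forall>\<^sub>F n in sequentially. agree F (ppow A x (fact n)) (pomega A x)"
  using pomega_conv[OF assms(1)] assms(2) by (simp add: pconv_def)

lemma pomega_agree2:
  assumes "x \<in> pOmega A" "y \<in> pOmega A" "finite F"
  obtains n where "agree F (ppow A x (fact n)) (pomega A x)"
    "agree F (ppow A y (fact n)) (pomega A y)"
  using eventually_happens[OF eventually_conj[OF pomega_agree[OF assms(1,3)] pomega_agree[OF assms(2,3)]]]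
  by auto

lemma pomega_eval:
  assumes "x \<in> pOmega A" "admissible A T e" "card (carrier T) \<le> n"
  shows "pomega A x T e = x T e [^]\<^bsub>T\<^esub> (fact n :: nat)"
proof -
  have "\<forall>\<^sub>F m in sequentially. agree {(T, e)} (ppow A x (fact m)) (pomega A x) \<and> card (carrier T) \<le> m"
    using pomega_agree[OF assms(1)] by (intro eventually_conj) (auto simp: eventually_sequentially)
  then obtain m where "agree {(T, e)} (ppow A x (fact m)) (pomega A x)" "card (carrier T) \<le> m"
    by (auto simp: eventually_sequentially)
  then show ?thesis
    using assms finite_monoid_power_fact(1)[of T "x T e" n] finite_monoid_power_fact(1)[of T "x T e" m]
      pOmega_carrier[OF assms(1,2)]
    by (simp add: agree_def ppow_eval admissible_def fin_mon_def)
qed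

lemma pmult_pomega_commute:
  assumes "x \<in> pOmega A" "y \<in> pOmega A"
  shows "pmult A x (pomega A (pmult A y x)) = pmult A (pomega A (pmult A x y)) x"
proof (rule pOmega_eqI[of _ A])
  fix T e assume T: "admissible A T e"
  interpret monoid T using T by (rule admissible_monoid)
  have c: "x T e \<in> carrier T" "y T e \<in> carrier T"
    using assms T pOmega_carrier by auto
  have "x T e \<otimes>\<^bsub>T\<^esub> (y T e \<otimes>\<^bsub>T\<^esub> x T e) [^]\<^bsub>T\<^esub> n
      = (x T e \<otimes>\<^bsub>T\<^esub> y T e) [^]\<^bsub>T\<^esub> n \<otimes>\<^bsub>T\<^esub> x T e" for n :: nat
    by (induction n) (use c in \<open>auto simp: m_assoc[symmetric]\<close>)
  then show "pmult A x (pomega A (pmult A y x)) T e = pmult A (pomega A (pmult A x y)) x T e"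
    using T assms pomega_eval[OF _ T order_refl] by (simp add: pmult_eval)
qed (use assms in auto)

section \<open>Density of words\<close>

text \<open>Implicit operations are evaluated only in monoids with carriers of naturals, so an
  auxiliary finite monoid of tuples, sets or sums must first be copied. Any injective coding will
  do.\<close>

definition nat_code :: "('c, 'm) monoid_scheme \<Rightarrow> 'c \<Rightarrow> nat" where
  "nat_code M = (SOME g. inj_on g (carrier M))"

definition nat_decode :: "('c, 'm) monoid_scheme \<Rightarrow> nat \<Rightarrow> 'c" where
  "nat_decode M = the_inv_into (carrier M) (nat_code M)"

definition nat_copy :: "('c, 'm) monoid_scheme \<Rightarrow> nat monoid" where
  "nat_copy M = \<lparr>carrier = nat_code M ` carrier M,
     mult = (\<lambda>x y. nat_code M (nat_decode M x \<otimes>\<^bsub>M\<^esub> nat_decode M y)),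
     one = nat_code M \<one>\<^bsub>M\<^esub>\<rparr>"

lemma nat_code_inj: "finite (carrier M) \<Longrightarrow> inj_on (nat_code M) (carrier M)"
  unfolding nat_code_def
  by (rule someI_ex[of "\<lambda>g. inj_on g (carrier M)"]) (auto dest: finite_imp_inj_to_nat_seg)

lemma nat_decode_code [simp]:
  "finite (carrier M) \<Longrightarrow> x \<in> carrier M \<Longrightarrow> nat_decode M (nat_code M x) = x"
  unfolding nat_decode_def by (rule the_inv_into_f_f[OF nat_code_inj])

lemma nat_copy_sel:
  "carrier (nat_copy M) = nat_code M ` carrier M"
  "\<one>\<^bsub>nat_copy M\<^esub> = nat_code M \<one>\<^bsub>M\<^esub>"
  "finite (carrier M) \<Longrightarrow> x \<in> carrier M \<Longrightarrow> y \<in> carrier M \<Longrightarrow>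
    nat_code M x \<otimes>\<^bsub>nat_copy M\<^esub> nat_code M y = nat_code M (x \<otimes>\<^bsub>M\<^esub> y)"
  by (simp_all add: nat_copy_def)

lemma fin_mon_nat_copy:
  assumes "monoid M" "finite (carrier M)"
  shows "fin_mon (nat_copy M)"
proof -
  interpret monoid M by fact
  have "monoid (nat_copy M)"
    by unfold_locales (use assms(2) in \<open>auto simp: nat_copy_sel m_assoc\<close>)
  then show ?thesis
    using assms(2) by (simp add: fin_mon_def nat_copy_sel)
qed

section \<open>Words as implicit operations\<close>

definition pword :: "'a set \<Rightarrow> 'a list \<Rightarrow> 'a iop" where
  "pword A x = foldr (\<lambda>a. pmult A (pgen A a)) x (pone A)"

lemma pword_simps [simp]:
  "pword A [] = pone A"
  "pword A (a # x) = pmult A (pgen A a) (pword A x)"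
  by (simp_all add: pword_def)

lemma pword_closed [simp, intro]: "x \<in> lists A \<Longrightarrow> pword A x \<in> pOmega A"
  by (induction x) auto

lemma pword_append:
  "x \<in> lists A \<Longrightarrow> y \<in> lists A \<Longrightarrow> pword A (x @ y) = pmult A (pword A x) (pword A y)"
  by (induction x) (auto simp: pmult_assoc)

text \<open>At admissible points this is the submonoid of the product of the monoids in
  \<open>F\<close> that the tuples of letter values generate. Its elements are by construction
  values of words.\<close>

definition word_tuples ::
    "'a set \<Rightarrow> (nat monoid \<times> ('a \<Rightarrow> nat)) set \<Rightarrow> (nat monoid \<times> ('a \<Rightarrow> nat) \<Rightarrow> nat) monoid" where
  "word_tuples A F = \<lparr>carrier = (\<lambda>x. \<lambda>(T, e)\<in>F. pword A x T e) ` lists A,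
     mult = (\<lambda>f g. \<lambda>(T, e)\<in>F. f (T, e) \<otimes>\<^bsub>T\<^esub> g (T, e)),
     one = (\<lambda>(T, e)\<in>F. \<one>\<^bsub>T\<^esub>)\<rparr>"

text \<open>Evaluate \<open>u\<close> once, in the monoid of value tuples at the tuples of the
  letters. The result is the tuple of some word \<open>x\<close>; naturality of \<open>u\<close>
  under each coordinate projection turns this into agreement with \<open>x\<close> at every
  point.\<close>

lemma word_density:
  assumes u: "u \<in> pOmega A" and F: "finite F"
  obtains x where "x \<in> lists A" "agree F u (pword A x)"
proof -
  \<comment> \<open>At other points all implicit operations are \<open>undefined\<close>, and
    \<open>T\<close> may fail to be a finite monoid.\<close>
  define G where "G = {(T, e) \<in> F. admissible A T e}"
  have G: "finite G" "\<And>T e. (T, e) \<in> G \<Longrightarrow> admissible A T e"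
    unfolding G_def using F by (auto intro: finite_subset)
  define M where "M = word_tuples A G"
  define val where "val x = (\<lambda>(T, e)\<in>G. pword A x T e)" for x
  have car: "carrier M = val ` lists A"
    by (simp add: M_def word_tuples_def val_def)
  have val_mult: "val x \<otimes>\<^bsub>M\<^esub> val y = val (x @ y)" if "x \<in> lists A" "y \<in> lists A" for x y
    using G(2) that
    by (auto simp: M_def word_tuples_def val_def pword_append pmult_eval fun_eq_iff)
  have val_one: "\<one>\<^bsub>M\<^esub> = val []"
    using G(2) by (auto simp: M_def word_tuples_def val_def pone_eval fun_eq_iff)
  have "monoid M"
  proof (rule monoidI, unfold car val_one)
    fix f g assume "f \<in> val ` lists A" "g \<in> val ` lists A"
    then obtain x y where "x \<in> lists A" "y \<in> lists A" "f = val x" "g = val y" by blast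
    then show "f \<otimes>\<^bsub>M\<^esub> g \<in> val ` lists A"
      by (metis val_mult append_in_lists_conv imageI)
  next
    fix f g k assume "f \<in> val ` lists A" "g \<in> val ` lists A" "k \<in> val ` lists A"
    then obtain x y z where "x \<in> lists A" "y \<in> lists A" "z \<in> lists A"
      "f = val x" "g = val y" "k = val z" by blast
    then show "f \<otimes>\<^bsub>M\<^esub> g \<otimes>\<^bsub>M\<^esub> k = f \<otimes>\<^bsub>M\<^esub> (g \<otimes>\<^bsub>M\<^esub> k)"
      by (metis val_mult append_in_lists_conv append_assoc)
  next
    fix f assume "f \<in> val ` lists A"
    then obtain x where "x \<in> lists A" "f = val x" by blast
    then show "val [] \<otimes>\<^bsub>M\<^esub> f = f" "f \<otimes>\<^bsub>M\<^esub> val [] = f"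
      by (simp_all add: val_mult)
  qed auto
  have "val x \<in> (\<Pi>\<^sub>E p\<in>G. carrier (fst p))" if x: "x \<in> lists A" for x
  proof (rule PiE_I)
    fix p assume p: "p \<in> G"
    obtain T e where "p = (T, e)" by (cases p)
    then show "val x p \<in> carrier (fst p)"
      using pOmega_carrier[OF pword_closed[OF x] G(2)] p by (simp add: val_def)
  qed (simp add: val_def)
  then have "carrier M \<subseteq> (\<Pi>\<^sub>E p\<in>G. carrier (fst p))"
    by (auto simp: car)
  moreover have "finite (\<Pi>\<^sub>E p\<in>G. carrier (fst p))"
    using G by (intro finite_PiE) (auto simp: admissible_def fin_mon_def)
  ultimately have fin: "finite (carrier M)"
    by (rule finite_subset)
  define N where "N = nat_copy M"
  define e0 where "e0 = (\<lambda>a\<in>A. nat_code M (val [a]))"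
  have N: "fin_mon N"
    unfolding N_def using \<open>monoid M\<close> fin by (rule fin_mon_nat_copy)
  have adm: "admissible A N e0"
    using N by (auto simp: admissible_def e0_def N_def nat_copy_sel car)
  then have "u N e0 \<in> carrier N"
    using u by (simp add: pOmega_carrier)
  then obtain x where x: "x \<in> lists A" "u N e0 = nat_code M (val x)"
    by (auto simp: N_def nat_copy_sel car)
  have "u T e = pword A x T e" if "(T, e) \<in> G" for T e
  proof -
    define h where "h = (\<lambda>n. nat_decode M n (T, e))"
    have T: "admissible A T e" "fin_mon T"
      using that G(2) by (auto simp: admissible_def)
    have h_val: "h (nat_code M (val y)) = pword A y T e" if "y \<in> lists A" for y
      using that \<open>(T, e) \<in> G\<close> fin by (simp add: h_def car val_def)
    have "h \<in> mon_hom N T"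
      unfolding mon_hom_def hom_def
    proof (intro CollectI conjI ballI funcsetI)
      show "h \<one>\<^bsub>N\<^esub> = \<one>\<^bsub>T\<^esub>"
        using h_val[of "[]"] T(1) by (simp add: N_def nat_copy_sel val_one pone_eval)
    next
      fix n assume "n \<in> carrier N"
      then obtain y where y: "y \<in> lists A" "n = nat_code M (val y)"
        by (auto simp: N_def nat_copy_sel car)
      then show "h n \<in> carrier T"
        using pOmega_carrier[OF pword_closed[OF y(1)] T(1)] h_val by simp
      fix m assume "m \<in> carrier N"
      then obtain z where z: "z \<in> lists A" "m = nat_code M (val z)"
        by (auto simp: N_def nat_copy_sel car)
      have "n \<otimes>\<^bsub>N\<^esub> m = nat_code M (val (y @ z))"
        using y z fin by (simp add: N_def nat_copy_sel car val_mult)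
      then show "h (n \<otimes>\<^bsub>N\<^esub> m) = h n \<otimes>\<^bsub>T\<^esub> h m"
        using y z T(1) h_val by (simp add: pword_append pmult_eval)
    qed
    moreover have "(\<lambda>a\<in>A. h (e0 a)) = e"
    proof
      fix a
      show "(\<lambda>a\<in>A. h (e0 a)) a = e a"
        using T(1) h_val[of "[a]"]
        by (cases "a \<in> A") (auto simp: e0_def pgen_eval admissible_def)
    qed
    ultimately have "h (u N e0) = u T e"
      using pOmega_hom[OF u adm T(2)] by metis
    then show ?thesis
      using h_val x by simp
  qed
  then have "agree F u (pword A x)"
    by (intro agreeI_admissible[of _ A]) (use u x in \<open>auto simp: G_def\<close>)
  then show thesis
    using that x(1) by blast
qed

section \<open>Subwords of implicit operations\<close>

definition conc :: "'a list set \<Rightarrow> 'a list set \<Rightarrow> 'a list set" where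
  "conc X Y = {x @ y | x y. x \<in> X \<and> y \<in> Y}"

lemma concI: "x \<in> X \<Longrightarrow> y \<in> Y \<Longrightarrow> x @ y \<in> conc X Y"
  by (auto simp: conc_def)

lemma concE:
  assumes "w \<in> conc X Y"
  obtains x y where "w = x @ y" "x \<in> X" "y \<in> Y"
  using assms by (auto simp: conc_def)

lemma conc_Nil [simp]: "conc {[]} X = X" "conc X {[]} = X"
  by (auto simp: conc_def)

text \<open>A word evaluates here to the set of its subwords of length at most \<open>k\<close>, so
  the words form the quotient by Simon's congruence of level \<open>k\<close>. The empty word in
  every set makes each factor a subset of the product.\<close>

definition subword_sets :: "'a set \<Rightarrow> nat \<Rightarrow> 'a list set monoid" where
  "subword_sets A k = \<lparr>carrier = {X. X \<subseteq> {w \<in> lists A. length w \<le> k} \<and> [] \<in> X},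
     mult = (\<lambda>X Y. {w \<in> conc X Y. length w \<le> k}), one = {[]}\<rparr>"

definition subword_gens :: "'a set \<Rightarrow> nat \<Rightarrow> 'a \<Rightarrow> nat" where
  "subword_gens A k = (\<lambda>a\<in>A. nat_code (subword_sets A k) {w. length w \<le> k \<and> subseq w [a]})"

text \<open>One finite monoid sees only subwords of bounded length, so each \<open>w\<close> is
  tested in the monoid of its own level.\<close>

definition subwords :: "'a set \<Rightarrow> 'a iop \<Rightarrow> 'a list set" where
  "subwords A u = {w. w \<in> nat_decode (subword_sets A (length w))
      (u (nat_copy (subword_sets A (length w))) (subword_gens A (length w)))}"

text \<open>Truncation respects associativity because the factors of a word of length at most
  \<open>k\<close> are again that short.\<close>

lemma monoid_subword_sets: "monoid (subword_sets A k)"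
proof (unfold_locales, goal_cases)
  case (1 x y)
  then have "[] \<in> conc x y" "conc x y \<subseteq> lists A"
    using concI[of "[]" x "[]" y] by (force simp: subword_sets_def elim!: concE)+
  then show ?case
    by (auto simp: subword_sets_def)
next
  case (2 x y z)
  let ?l = "\<lambda>X. {w \<in> X. length w \<le> k}"
  have "?l (conc (?l (conc x y)) z) = ?l (conc x (?l (conc y z)))"
  proof (intro equalityI subsetI)
    fix w assume "w \<in> ?l (conc (?l (conc x y)) z)"
    then obtain a b c where abc: "a \<in> x" "b \<in> y" "c \<in> z" "w = a @ b @ c" "length w \<le> k"
      by (auto elim!: concE)
    then have "b @ c \<in> ?l (conc y z)"
      using concI[of b y c z] by simp
    with abc show "w \<in> ?l (conc x (?l (conc y z)))"
      using concI[of a x "b @ c"] by simp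
  next
    fix w assume "w \<in> ?l (conc x (?l (conc y z)))"
    then obtain a b c where abc: "a \<in> x" "b \<in> y" "c \<in> z" "w = (a @ b) @ c" "length w \<le> k"
      by (auto elim!: concE)
    then have "a @ b \<in> ?l (conc x y)"
      using concI[of a x b y] by simp
    with abc show "w \<in> ?l (conc (?l (conc x y)) z)"
      using concI[of "a @ b" _ c z] by simp
  qed
  then show ?case by (simp add: subword_sets_def)
qed (auto simp: subword_sets_def)

lemma finite_subword_sets: "finite A \<Longrightarrow> finite (carrier (subword_sets A k))"
proof -
  assume "finite A"
  then have "finite (Pow {w. set w \<subseteq> A \<and> length w \<le> k})"
    by (simp add: finite_lists_length_le)
  then show ?thesis
    by (rule rev_finite_subset) (auto simp: subword_sets_def)
qed

lemma subseq_set_mono: "subseq w x \<Longrightarrow> set w \<subseteq> set x"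
  by (metis notin_set_nthsI subseq_conv_nths subsetI)

lemma bounded_subwords_carrier:
  "x \<in> lists A \<Longrightarrow> {w. length w \<le> k \<and> subseq w x} \<in> carrier (subword_sets A k)"
  using subseq_set_mono by (fastforce simp: subword_sets_def)

lemma admissible_subword_sets:
  assumes "finite A"
  shows "admissible A (nat_copy (subword_sets A k)) (subword_gens A k)"
  using assms fin_mon_nat_copy[OF monoid_subword_sets finite_subword_sets]
    bounded_subwords_carrier[of "[_]" A k]
  by (auto simp: admissible_def subword_gens_def nat_copy_sel)

lemma pword_subword_sets:
  assumes "finite A" "x \<in> lists A"
  shows "pword A x (nat_copy (subword_sets A k)) (subword_gens A k) =
    nat_code (subword_sets A k) {w. length w \<le> k \<and> subseq w x}"
  using assms(2)
proof (induction x)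
  case Nil
  have "{w. length w \<le> k \<and> subseq w []} = \<one>\<^bsub>subword_sets A k\<^esub>"
    by (auto simp: subword_sets_def)
  then show ?case
    using admissible_subword_sets[OF assms(1)] by (simp add: pone_eval nat_copy_sel)
next
  case (Cons a x)
  let ?M = "subword_sets A k" and ?S = "\<lambda>x. {w. length w \<le> k \<and> subseq w x}"
  have "?S [a] \<in> carrier ?M" "?S x \<in> carrier ?M"
    using Cons by (auto intro!: bounded_subwords_carrier)
  moreover have "?S [a] \<otimes>\<^bsub>?M\<^esub> ?S x = ?S (a # x)"
  proof (rule Set.set_eqI, rule iffI)
    fix w assume "w \<in> ?S [a] \<otimes>\<^bsub>?M\<^esub> ?S x"
    then show "w \<in> ?S (a # x)"
      using subseq_append_iff[of w "[a]" x] by (simp add: subword_sets_def conc_def) blast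
  next
    fix w assume w: "w \<in> ?S (a # x)"
    then obtain v z where "w = v @ z" "subseq v [a]" "subseq z x"
      using subseq_append_iff[of w "[a]" x] by auto
    with w concI[of v "?S [a]" z "?S x"] show "w \<in> ?S [a] \<otimes>\<^bsub>?M\<^esub> ?S x"
      by (simp add: subword_sets_def)
  qed
  moreover have "subword_gens A k a = nat_code ?M (?S [a])"
    using Cons by (simp add: subword_gens_def)
  ultimately show ?case
    using admissible_subword_sets[OF assms(1)] Cons finite_subword_sets[OF assms(1)]
    by (simp add: pmult_eval pgen_eval nat_copy_sel)
qed

lemma subwords_agree:
  assumes "finite A" "x \<in> lists A"
    and "agree {(nat_copy (subword_sets A (length w)), subword_gens A (length w))} u (pword A x)"
  shows "w \<in> subwords A u \<longleftrightarrow> subseq w x"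
  using assms bounded_subwords_carrier[OF assms(2)] finite_subword_sets[OF assms(1)]
  by (simp add: agree_def subwords_def pword_subword_sets)

text \<open>The subwords up to length \<open>k\<close> are read off at finitely many points, one for
  each level; density is applied to \<open>F\<close> together with these.\<close>

lemma subwords_density:
  assumes "finite A" "u \<in> pOmega A" "finite F"
  obtains x where "x \<in> lists A" "agree F u (pword A x)"
    "\<forall>w. length w \<le> k \<longrightarrow> (w \<in> subwords A u \<longleftrightarrow> subseq w x)"
proof -
  let ?G = "(\<lambda>l. (nat_copy (subword_sets A l), subword_gens A l)) ` {..k}"
  obtain x where x: "x \<in> lists A" "agree (F \<union> ?G) u (pword A x)"
    using word_density[OF assms(2), of "F \<union> ?G"] assms(3) by auto
  have "w \<in> subwords A u \<longleftrightarrow> subseq w x" if "length w \<le> k" for w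
    using x that by (intro subwords_agree[OF assms(1)]) (auto elim: agree_subset)
  then have "\<forall>w. length w \<le> k \<longrightarrow> (w \<in> subwords A u \<longleftrightarrow> subseq w x)"
    by blast
  moreover have "agree F u (pword A x)"
    using x(2) by (rule agree_subset) auto
  ultimately show thesis
    using that x(1) by blast
qed

lemma subwords_pword: "finite A \<Longrightarrow> x \<in> lists A \<Longrightarrow> subwords A (pword A x) = {w. subseq w x}"
  using subwords_agree[of A x] by auto

lemma subwords_pone: "finite A \<Longrightarrow> subwords A (pone A) = {[]}"
  using subwords_pword[of A "[]"] by auto

lemma subwords_pgen:
  assumes "finite A" "a \<in> A"
  shows "subwords A (pgen A a) = {[], [a]}"
proof -
  have "subseq w [a] \<longleftrightarrow> w = [] \<or> w = [a]" for w
    by (cases w) auto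
  then show ?thesis
    using subwords_pword[of A "[a]"] assms by auto
qed

text \<open>Both operations are replaced by words with the same subwords up to the length of
  \<open>w\<close>. A decomposition of \<open>w\<close> involves no longer words, so the claim
  becomes the one for a concatenation.\<close>

lemma subwords_pmult:
  fixes A :: "'a set"
  assumes "finite A" "u \<in> pOmega A" "v \<in> pOmega A"
  shows "subwords A (pmult A u v) = conc (subwords A u) (subwords A v)"
proof (rule Set.set_eqI)
  fix w :: "'a list"
  let ?F = "{(nat_copy (subword_sets A (length w)), subword_gens A (length w))}"
  obtain x where x: "x \<in> lists A" "agree ?F u (pword A x)"
    "\<forall>z. length z \<le> length w \<longrightarrow> (z \<in> subwords A u \<longleftrightarrow> subseq z x)"
    by (rule subwords_density[OF assms(1,2) finite.insertI[OF finite.emptyI]])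
  obtain y where y: "y \<in> lists A" "agree ?F v (pword A y)"
    "\<forall>z. length z \<le> length w \<longrightarrow> (z \<in> subwords A v \<longleftrightarrow> subseq z y)"
    by (rule subwords_density[OF assms(1,3) finite.insertI[OF finite.emptyI]])
  have "w \<in> subwords A (pmult A u v) \<longleftrightarrow> subseq w (x @ y)"
    using x y agree_pmult[OF x(2) y(2)] by (intro subwords_agree[OF assms(1)]) (auto simp: pword_append)
  also have "\<dots> \<longleftrightarrow> (\<exists>a b. w = a @ b \<and> subseq a x \<and> subseq b y)"
    by (rule subseq_append_iff)
  also have "\<dots> \<longleftrightarrow> (\<exists>a b. w = a @ b \<and> a \<in> subwords A u \<and> b \<in> subwords A v)"
  proof -
    have "subseq a x \<and> subseq b y \<longleftrightarrow> a \<in> subwords A u \<and> b \<in> subwords A v" if "w = a @ b" for a b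
      using x(3)[rule_format, of a] y(3)[rule_format, of b] that by simp
    then show ?thesis by blast
  qed
  also have "\<dots> \<longleftrightarrow> w \<in> conc (subwords A u) (subwords A v)"
    by (simp add: conc_def)
  finally show "w \<in> subwords A (pmult A u v) \<longleftrightarrow> w \<in> conc (subwords A u) (subwords A v)" .
qed

lemma Nil_in_subwords:
  assumes "finite A" "u \<in> pOmega A"
  shows "[] \<in> subwords A u"
proof -
  obtain x where "x \<in> lists A" "agree {} u (pword A x)"
    "\<forall>w. length w \<le> length [] \<longrightarrow> (w \<in> subwords A u \<longleftrightarrow> subseq w x)"
    by (rule subwords_density[OF assms finite.emptyI])
  from this(3)[rule_format, of "[]"] show ?thesis by simp
qed

section \<open>Content\<close>

definition content :: "'a set \<Rightarrow> 'a iop \<Rightarrow> 'a set" where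
  "content A u = {a. [a] \<in> subwords A u}"

lemma content_subset:
  assumes "finite A" "u \<in> pOmega A"
  shows "content A u \<subseteq> A"
proof
  fix a assume a: "a \<in> content A u"
  obtain x where x: "x \<in> lists A" "agree {} u (pword A x)"
    "\<forall>w. length w \<le> 1 \<longrightarrow> (w \<in> subwords A u \<longleftrightarrow> subseq w x)"
    by (rule subwords_density[OF assms finite.emptyI])
  show "a \<in> A"
    using a x(1) x(3)[rule_format, of "[a]"] by (auto simp: content_def subseq_singleton_left)
qed

lemma content_pmult:
  fixes A :: "'a set"
  assumes "finite A" "u \<in> pOmega A" "v \<in> pOmega A"
  shows "content A (pmult A u v) = content A u \<union> content A v"
proof -
  have "[a] \<in> conc X Y \<longleftrightarrow> [a] \<in> X \<or> [a] \<in> Y" if "[] \<in> X" "[] \<in> Y" for a and X Y :: "'a list set"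
    using that by (auto simp: conc_def Cons_eq_append_conv)
  then show ?thesis
    using Nil_in_subwords[OF assms(1)] assms by (simp add: content_def subwords_pmult Collect_disj_eq)
qed

lemma content_pgen: "finite A \<Longrightarrow> a \<in> A \<Longrightarrow> content A (pgen A a) = {a}"
  by (auto simp: content_def subwords_pgen)

lemma content_density:
  assumes "finite A" "u \<in> pOmega A" "finite F"
  obtains x where "x \<in> lists (content A u)" "x \<in> lists A" "agree F u (pword A x)"
    "\<forall>w. length w \<le> k \<longrightarrow> (w \<in> subwords A u \<longleftrightarrow> subseq w x)"
proof -
  \<comment> \<open>The bound is at least 1 so that each letter of \<open>x\<close>, being a subword
    of length 1, is seen to belong to the content.\<close>
  obtain x where x: "x \<in> lists A" "agree F u (pword A x)"
    "\<forall>w. length w \<le> max 1 k \<longrightarrow> (w \<in> subwords A u \<longleftrightarrow> subseq w x)"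
    by (rule subwords_density[OF assms])
  have "x \<in> lists (content A u)"
  proof (rule in_listsI, rule ballI)
    fix a assume "a \<in> set x"
    then show "a \<in> content A u"
      using x(3)[rule_format, of "[a]"] by (simp add: content_def subseq_singleton_left)
  qed
  with x that show thesis by simp
qed

lemma content_word_density:
  assumes "finite A" "u \<in> pOmega A" "finite F"
  obtains x where "x \<in> lists (content A u)" "agree F u (pword A x)"
  using that by (rule content_density[OF assms, where k = 0])

lemma subwords_subset_lists:
  assumes "finite A" "u \<in> pOmega A"
  shows "subwords A u \<subseteq> lists (content A u)"
proof
  fix w assume w: "w \<in> subwords A u"
  obtain x where x: "x \<in> lists (content A u)"
    "x \<in> lists A" "agree {} u (pword A x)"
    "\<forall>v. length v \<le> length w \<longrightarrow> (v \<in> subwords A u \<longleftrightarrow> subseq v x)"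
    by (rule content_density[OF assms finite.emptyI])
  then show "w \<in> lists (content A u)"
    using w subseq_set_mono[of w x] x(4)[rule_format, of w] by auto
qed

section \<open>Factorization at the first occurrence of a letter\<close>

text \<open>\<open>Inl t\<close> stands for a word without the marked letter that evaluates to \<open>t\<close>, and
\<open>Inr (s, t)\<close> for a word whose factors before and after the first occurrence of the marked letter
evaluate to \<open>s\<close> and \<open>t\<close>; the marked letter itself evaluates to \<open>c\<close>.\<close>

fun cut_mult :: "nat monoid \<Rightarrow> nat \<Rightarrow> nat + nat \<times> nat \<Rightarrow> nat + nat \<times> nat \<Rightarrow> nat + nat \<times> nat" where
  "cut_mult T c (Inl s) (Inl t) = Inl (s \<otimes>\<^bsub>T\<^esub> t)"
| "cut_mult T c (Inl s) (Inr (t, t')) = Inr (s \<otimes>\<^bsub>T\<^esub> t, t')"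
| "cut_mult T c (Inr (s, s')) (Inl t) = Inr (s, s' \<otimes>\<^bsub>T\<^esub> t)"
| "cut_mult T c (Inr (s, s')) (Inr (t, t')) = Inr (s, s' \<otimes>\<^bsub>T\<^esub> (t \<otimes>\<^bsub>T\<^esub> (c \<otimes>\<^bsub>T\<^esub> t')))"

definition cut :: "nat monoid \<Rightarrow> nat \<Rightarrow> (nat + nat \<times> nat) monoid" where
  "cut T c = \<lparr>carrier = carrier T <+> carrier T \<times> carrier T, mult = cut_mult T c, one = Inl \<one>\<^bsub>T\<^esub>\<rparr>"

definition cut_gens :: "'a set \<Rightarrow> 'a \<Rightarrow> nat monoid \<Rightarrow> ('a \<Rightarrow> nat) \<Rightarrow> 'a \<Rightarrow> nat" where
  "cut_gens A b T e = (\<lambda>a\<in>A. nat_code (cut T (e b))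
     (if a = b then Inr (\<one>\<^bsub>T\<^esub>, \<one>\<^bsub>T\<^esub>) else Inl (e a)))"

definition cut_value :: "'a set \<Rightarrow> 'a \<Rightarrow> 'a iop \<Rightarrow> nat monoid \<Rightarrow> ('a \<Rightarrow> nat) \<Rightarrow> nat + nat \<times> nat" where
  "cut_value A b u T e = nat_decode (cut T (e b)) (u (nat_copy (cut T (e b))) (cut_gens A b T e))"

text \<open>The projection is meaningful when \<open>b\<close> occurs in \<open>u\<close>; otherwise
  the value lies in the \<open>Inl\<close> part and \<open>projr\<close> is unspecified. This is why
  the content is mentioned wherever properties of the two factors are derived.\<close>

definition before :: "'a set \<Rightarrow> 'a \<Rightarrow> 'a iop \<Rightarrow> 'a iop" where
  "before A b u = (\<lambda>T e. if admissible A T e then fst (projr (cut_value A b u T e)) else undefined)"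

definition after :: "'a set \<Rightarrow> 'a \<Rightarrow> 'a iop \<Rightarrow> 'a iop" where
  "after A b u = (\<lambda>T e. if admissible A T e then snd (projr (cut_value A b u T e)) else undefined)"

lemma carrier_cut: "carrier (cut T c) = carrier T <+> carrier T \<times> carrier T"
  by (simp add: cut_def)

lemma monoid_cut:
  assumes "monoid T" "c \<in> carrier T"
  shows "monoid (cut T c)"
proof -
  interpret monoid T by fact
  show ?thesis
    by (rule monoidI) (use assms(2) in \<open>auto simp: cut_def m_assoc\<close>)
qed

lemma finite_cut: "fin_mon T \<Longrightarrow> finite (carrier (cut T c))"
  by (simp add: fin_mon_def carrier_cut)

lemma admissible_cut:
  assumes "admissible A T e" "b \<in> A"
  shows "admissible A (nat_copy (cut T (e b))) (cut_gens A b T e)"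
proof -
  have T: "fin_mon T" "monoid T" "e b \<in> carrier T"
    using assms by (auto simp: admissible_def fin_mon_def)
  interpret monoid T by fact
  show ?thesis
    using assms fin_mon_nat_copy[OF monoid_cut[OF T(2,3)] finite_cut[OF T(1)]]
    by (auto simp: admissible_def cut_gens_def nat_copy_sel carrier_cut intro!: imageI)
qed

lemma cut_value_carrier:
  assumes "admissible A T e" "b \<in> A" "u \<in> pOmega A"
  shows "cut_value A b u T e \<in> carrier (cut T (e b))"
    and "u (nat_copy (cut T (e b))) (cut_gens A b T e) =
      nat_code (cut T (e b)) (cut_value A b u T e)"
proof -
  obtain m where "m \<in> carrier (cut T (e b))"
    "u (nat_copy (cut T (e b))) (cut_gens A b T e) = nat_code (cut T (e b)) m"
    using pOmega_carrier[OF assms(3) admissible_cut[OF assms(1,2)]] by (auto simp: nat_copy_sel)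
  then show "cut_value A b u T e \<in> carrier (cut T (e b))"
    "u (nat_copy (cut T (e b))) (cut_gens A b T e) = nat_code (cut T (e b)) (cut_value A b u T e)"
    using assms(1) by (simp_all add: cut_value_def finite_cut admissible_def)
qed

lemma split_at_first:
  "b \<in> set x \<Longrightarrow> x = takeWhile (\<lambda>a. a \<noteq> b) x @ b # tl (dropWhile (\<lambda>a. a \<noteq> b) x)"
  by (induction x) auto

text \<open>On words the cut monoid really computes the factors around the first \<open>b\<close>;
  density transfers this to implicit operations.\<close>

lemma cut_value_pword:
  assumes T: "admissible A T e" and b: "b \<in> A" and x: "x \<in> lists A"
  shows "cut_value A b (pword A x) T e =
    (if b \<in> set x then Inr (pword A (takeWhile (\<lambda>a. a \<noteq> b) x) T e,
        pword A (tl (dropWhile (\<lambda>a. a \<noteq> b) x)) T e)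
     else Inl (pword A x T e))"
  using x
proof (induction x)
  let ?M = "cut T (e b)"
  note adm = admissible_cut[OF T b]
  have fin: "finite (carrier ?M)"
    using T by (simp add: finite_cut admissible_def)
  interpret monoid T using T by (rule admissible_monoid)
  {
    case Nil
    have "\<one>\<^bsub>?M\<^esub> = Inl \<one>\<^bsub>T\<^esub>" "Inl \<one>\<^bsub>T\<^esub> \<in> carrier ?M"
      by (auto simp: cut_def)
    then show ?case
      using fin adm T by (simp add: cut_value_def pone_eval nat_copy_sel)
  next
    case (Cons a x)
    let ?g = "if a = b then Inr (\<one>\<^bsub>T\<^esub>, \<one>\<^bsub>T\<^esub>) else Inl (e a)"
    have a: "a \<in> A" "x \<in> lists A" using Cons by auto
    have g: "?g \<in> carrier ?M" "cut_gens A b T e a = nat_code ?M ?g"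
      using T a by (auto simp: carrier_cut admissible_carrier cut_gens_def)
    note v = cut_value_carrier[OF T b pword_closed[OF a(2)]]
    have "?g \<otimes>\<^bsub>?M\<^esub> cut_value A b (pword A x) T e \<in> carrier ?M"
      using g v(1) monoid.m_closed[OF monoid_cut[OF monoid_axioms]] T b by (simp add: admissible_carrier)
    then have "cut_value A b (pword A (a # x)) T e = ?g \<otimes>\<^bsub>?M\<^esub> cut_value A b (pword A x) T e"
      unfolding cut_value_def[of A b "pword A (a # x)"]
      using g v adm fin by (simp add: pmult_eval pgen_eval nat_copy_sel)
    also have "\<dots> = cut_mult T (e b) ?g (cut_value A b (pword A x) T e)"
      by (simp add: cut_def)
    finally have eq: "cut_value A b (pword A (a # x)) T e =
        cut_mult T (e b) ?g (cut_value A b (pword A x) T e)" .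
    have car: "pword A y T e \<in> carrier T" if "set y \<subseteq> set x" for y
      using that a(2) T by (intro pOmega_carrier[OF pword_closed]) auto
    have sub: "set (takeWhile (\<lambda>a. a \<noteq> b) x) \<subseteq> set x" "set (tl (dropWhile (\<lambda>a. a \<noteq> b) x)) \<subseteq> set x"
      by (induction x) auto
    have spl: "pword A x T e = pword A (takeWhile (\<lambda>a. a \<noteq> b) x) T e \<otimes>\<^bsub>T\<^esub>
        (e b \<otimes>\<^bsub>T\<^esub> pword A (tl (dropWhile (\<lambda>a. a \<noteq> b) x)) T e)" if "b \<in> set x"
    proof -
      have "x = takeWhile (\<lambda>a. a \<noteq> b) x @ b # tl (dropWhile (\<lambda>a. a \<noteq> b) x)"
        using that by (rule split_at_first)
      moreover have "takeWhile (\<lambda>a. a \<noteq> b) x \<in> lists A"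
        "b # tl (dropWhile (\<lambda>a. a \<noteq> b) x) \<in> lists A"
        using sub a b by auto
      ultimately show ?thesis
        using pword_append[of "takeWhile (\<lambda>a. a \<noteq> b) x" A "b # tl (dropWhile (\<lambda>a. a \<noteq> b) x)"]
        by (simp add: pmult_eval[OF T] pgen_eval[OF T])
    qed
    show ?case
      using eq Cons.IH spl car[of x] car[OF sub(1)] car[OF sub(2)] T a admissible_carrier[OF T a(1)]
      by (auto simp: pmult_eval pgen_eval pone_eval)
  }
qed

text \<open>The point in the cut monoid is added to \<open>F\<close>, so one word both represents
  \<open>u\<close> on \<open>F\<close> and exhibits the two factors at \<open>(T, e)\<close>. The
  word depends on the point, whereas \<open>before\<close> and \<open>after\<close> are defined
  without reference to it.\<close>

lemma cut_value_density:
  assumes "finite A" "u \<in> pOmega A" "b \<in> content A u" "admissible A T e" "finite F"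
  obtains x where "x \<in> lists A" "agree F u (pword A x)"
    "before A b u T e = pword A (takeWhile (\<lambda>a. a \<noteq> b) x) T e"
    "after A b u T e = pword A (tl (dropWhile (\<lambda>a. a \<noteq> b) x)) T e"
    "cut_value A b u T e = Inr (before A b u T e, after A b u T e)"
    "b \<in> set x"
proof -
  have b: "b \<in> A" using content_subset assms by blast
  let ?G = "insert (nat_copy (cut T (e b)), cut_gens A b T e) F"
  obtain x where x: "x \<in> lists A" "agree ?G u (pword A x)"
    "\<forall>w. length w \<le> 1 \<longrightarrow> (w \<in> subwords A u \<longleftrightarrow> subseq w x)"
    by (rule subwords_density[OF assms(1,2) finite.insertI[OF assms(5)]])
  have "b \<in> set x" using assms(3) x(3)[rule_format, of "[b]"] by (simp add: content_def subseq_singleton_left)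
  moreover have "cut_value A b u T e = cut_value A b (pword A x) T e"
    using x(2) by (simp add: cut_value_def agree_def)
  moreover have "agree F u (pword A x)"
    using x(2) by (rule agree_subset) auto
  ultimately show thesis
    using that[OF x(1)] assms(4) cut_value_pword[OF assms(4) b x(1)]
    by (simp add: before_def after_def)
qed

text \<open>Applying \<open>h\<close> in every component is a homomorphism of cut monoids, since the
  marked letter \<open>e b\<close> goes to \<open>h (e b)\<close>, and it maps generators to
  generators. Naturality of \<open>u\<close> along this map is naturality of its two
  factors.\<close>

lemma before_after_hom:
  assumes A: "finite A" "u \<in> pOmega A" "b \<in> content A u"
    and *: "admissible A S e" "fin_mon T" "h \<in> mon_hom S T"
  shows "h (before A b u S e) = before A b u T (\<lambda>a\<in>A. h (e a))"
    and "h (after A b u S e) = after A b u T (\<lambda>a\<in>A. h (e a))"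
proof -
  have b: "b \<in> A" using content_subset A by blast
  define e' where "e' = (\<lambda>a\<in>A. h (e a))"
  have adm: "admissible A T e'"
    unfolding e'_def using * by (rule admissible_hom)
  let ?M = "cut S (e b)" and ?N = "cut T (e' b)"
  define m where "m = map_sum h (map_prod h h)"
  define k where "k = (\<lambda>n. nat_code ?N (m (nat_decode ?M n)))"
  interpret S: monoid S using *(1) by (rule admissible_monoid)
  interpret T: monoid T using *(2) by (rule fin_mon_monoid)
  have h: "h s \<in> carrier T" if "s \<in> carrier S" for s
    using *(3) that by (auto simp: mon_hom_def hom_def)
  have eb: "e b \<in> carrier S" "e' b = h (e b)"
    using *(1) b by (auto simp: admissible_carrier e'_def)
  have m_car: "m z \<in> carrier ?N" if "z \<in> carrier ?M" for z
    using that h by (auto simp: carrier_cut m_def)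
  have m_mult: "m (y \<otimes>\<^bsub>?M\<^esub> z) = m y \<otimes>\<^bsub>?N\<^esub> m z" if "y \<in> carrier ?M" "z \<in> carrier ?M" for y z
    using that eb *(3) by (auto simp: carrier_cut m_def cut_def mon_hom_mult)
  have m_one: "m \<one>\<^bsub>?M\<^esub> = \<one>\<^bsub>?N\<^esub>"
    using *(3) by (simp add: cut_def m_def mon_hom_one)
  have fin: "finite (carrier ?M)" "finite (carrier ?N)"
    using * by (auto simp: finite_cut admissible_def)
  interpret M: monoid ?M by (rule monoid_cut) (use eb S.monoid_axioms in auto)
  have k_hom: "k \<in> mon_hom (nat_copy ?M) (nat_copy ?N)"
    using fin m_car m_mult m_one by (auto simp: mon_hom_def hom_def k_def nat_copy_sel)
  have gens: "(\<lambda>a\<in>A. k (cut_gens A b S e a)) = cut_gens A b T e'"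
  proof
    fix a
    let ?g = "if a = b then Inr (\<one>\<^bsub>S\<^esub>, \<one>\<^bsub>S\<^esub>) else Inl (e a)"
    have "?g \<in> carrier ?M" if "a \<in> A"
      using that *(1) by (auto simp: carrier_cut admissible_carrier)
    moreover have "m ?g = (if a = b then Inr (\<one>\<^bsub>T\<^esub>, \<one>\<^bsub>T\<^esub>) else Inl (e' a))" if "a \<in> A"
      using that *(3) by (simp add: m_def mon_hom_one e'_def)
    ultimately show "(\<lambda>a\<in>A. k (cut_gens A b S e a)) a = cut_gens A b T e' a"
      using fin(1) by (cases "a \<in> A") (simp_all only: cut_gens_def k_def restrict_apply
          if_True if_False nat_decode_code)
  qed
  have "fin_mon (nat_copy ?N)"
    using admissible_cut[OF adm b] by (simp add: admissible_def)
  then have "k (u (nat_copy ?M) (cut_gens A b S e)) = u (nat_copy ?N) (cut_gens A b T e')"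
    using pOmega_hom[OF A(2) admissible_cut[OF *(1) b] _ k_hom] gens by simp
  then have "m (cut_value A b u S e) = cut_value A b u T e'"
    using fin m_car cut_value_carrier[OF *(1) b A(2)] cut_value_carrier[OF adm b A(2)]
    by (simp add: k_def inj_on_eq_iff[OF nat_code_inj])
  moreover have "cut_value A b u S e = Inr (before A b u S e, after A b u S e)"
    by (rule cut_value_density[OF A *(1) finite.emptyI])
  moreover have "cut_value A b u T e' = Inr (before A b u T e', after A b u T e')"
    by (rule cut_value_density[OF A adm finite.emptyI])
  ultimately show "h (before A b u S e) = before A b u T (\<lambda>a\<in>A. h (e a))"
    "h (after A b u S e) = after A b u T (\<lambda>a\<in>A. h (e a))"
    by (simp_all add: m_def e'_def)
qed

text \<open>At each point the equation comes from splitting a word that represents \<open>u\<close>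
  there; naturality of the factors makes it an equation between implicit operations.\<close>

lemma first_occurrence:
  assumes A: "finite A" "u \<in> pOmega A" "b \<in> content A u"
  obtains u' u'' where "u' \<in> pOmega A" "u'' \<in> pOmega A" "b \<notin> content A u'"
    "u = pmult A u' (pmult A (pgen A b) u'')"
proof -
  have b: "b \<in> A" using content_subset A by blast
  have val: "before A b u T e \<in> carrier T \<and> after A b u T e \<in> carrier T \<and>
      u T e = before A b u T e \<otimes>\<^bsub>T\<^esub> (e b \<otimes>\<^bsub>T\<^esub> after A b u T e)"
    if T: "admissible A T e" for T e
  proof -
    obtain x where x: "x \<in> lists A" "agree {(T, e)} u (pword A x)"
      "before A b u T e = pword A (takeWhile (\<lambda>a. a \<noteq> b) x) T e"
      "after A b u T e = pword A (tl (dropWhile (\<lambda>a. a \<noteq> b) x)) T e"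
      "cut_value A b u T e = Inr (before A b u T e, after A b u T e)" "b \<in> set x"
      by (rule cut_value_density[OF A T finite.insertI[OF finite.emptyI]])
    have spl: "x = takeWhile (\<lambda>a. a \<noteq> b) x @ b # tl (dropWhile (\<lambda>a. a \<noteq> b) x)"
      using x(6) by (rule split_at_first)
    then have "takeWhile (\<lambda>a. a \<noteq> b) x @ b # tl (dropWhile (\<lambda>a. a \<noteq> b) x) \<in> lists A"
      using x(1) by simp
    then have l: "takeWhile (\<lambda>a. a \<noteq> b) x \<in> lists A" "tl (dropWhile (\<lambda>a. a \<noteq> b) x) \<in> lists A"
      by simp_all
    have "pword A x T e = before A b u T e \<otimes>\<^bsub>T\<^esub> (e b \<otimes>\<^bsub>T\<^esub> after A b u T e)"
      using pword_append[OF l(1), of "b # tl (dropWhile (\<lambda>a. a \<noteq> b) x)"] l b x(3,4) spl T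
      by (simp add: pmult_eval pgen_eval)
    then show ?thesis
      using x(2,3,4) pOmega_carrier[OF pword_closed[OF l(1)] T] pOmega_carrier[OF pword_closed[OF l(2)] T]
      by (simp add: agree_def)
  qed
  have in_Omega: "before A b u \<in> pOmega A" "after A b u \<in> pOmega A"
  proof -
    show "before A b u \<in> pOmega A"
    proof (rule pOmegaI)
      show "before A b u T e = undefined" if "\<not> admissible A T e" for T e
        using that by (simp add: before_def)
    qed (simp_all add: val before_after_hom[OF A])
    show "after A b u \<in> pOmega A"
    proof (rule pOmegaI)
      show "after A b u T e = undefined" if "\<not> admissible A T e" for T e
        using that by (simp add: after_def)
    qed (simp_all add: val before_after_hom[OF A])
  qed
  moreover have "u = pmult A (before A b u) (pmult A (pgen A b) (after A b u))"
    by (rule pOmega_eqI[of _ A]) (use A b in_Omega val in \<open>auto simp: pmult_eval pgen_eval\<close>)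
  moreover have "b \<notin> content A (before A b u)"
  proof -
    \<comment> \<open>The point at which \<open>subwords\<close> tests the word \<open>[b]\<close>;
      \<open>length [b]\<close> is left unevaluated to match that definition.\<close>
    let ?T = "nat_copy (subword_sets A (length [b]))" and ?e = "subword_gens A (length [b])"
    obtain x where x: "x \<in> lists A" "agree {} u (pword A x)"
      "before A b u ?T ?e = pword A (takeWhile (\<lambda>a. a \<noteq> b) x) ?T ?e"
      "after A b u ?T ?e = pword A (tl (dropWhile (\<lambda>a. a \<noteq> b) x)) ?T ?e"
      "cut_value A b u ?T ?e = Inr (before A b u ?T ?e, after A b u ?T ?e)" "b \<in> set x"
      by (rule cut_value_density[OF A admissible_subword_sets[OF A(1)] finite.emptyI])
    have "takeWhile (\<lambda>a. a \<noteq> b) x \<in> lists A"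
      using x(1) set_takeWhileD by fastforce
    then have "[b] \<in> subwords A (before A b u) \<longleftrightarrow> subseq [b] (takeWhile (\<lambda>a. a \<noteq> b) x)"
      using x(3) by (intro subwords_agree[OF A(1)]) (simp_all add: agree_def)
    then show ?thesis
      using set_takeWhileD[of b] by (auto simp: content_def subseq_singleton_left)
  qed
  ultimately show thesis
    using that by blast
qed

section \<open>Closed congruences\<close>

text \<open>The provability relations of both systems are instances, so normal forms are treated
  once for both.\<close>

locale closed_congruence =
  fixes A :: "'a set" and eqv :: "'a iop \<Rightarrow> 'a iop \<Rightarrow> bool" (infix "\<approx>" 50)
  assumes finite_alphabet: "finite A"
    and eqv_refl: "u \<in> pOmega A \<Longrightarrow> u \<approx> u"
    and eqv_sym: "u \<approx> v \<Longrightarrow> v \<approx> u"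
    and eqv_trans [trans]: "u \<approx> v \<Longrightarrow> v \<approx> w \<Longrightarrow> u \<approx> w"
    and eqv_left: "u \<approx> v \<Longrightarrow> w \<in> pOmega A \<Longrightarrow> pmult A w u \<approx> pmult A w v"
    and eqv_right: "u \<approx> v \<Longrightarrow> w \<in> pOmega A \<Longrightarrow> pmult A u w \<approx> pmult A v w"
    and eqv_closed: "pair_closure A {(u, v). u \<approx> v} \<subseteq> {(u, v). u \<approx> v}"
begin

abbreviation mul (infixl "\<cdot>" 70) where "u \<cdot> v \<equiv> pmult A u v"

lemma eq_eqv_trans [trans]: "u = v \<Longrightarrow> v \<approx> w \<Longrightarrow> u \<approx> w"
  by simp

lemma eqv_eq_trans [trans]: "u \<approx> v \<Longrightarrow> v = w \<Longrightarrow> u \<approx> w"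
  by simp

lemma eqv_limit:
  assumes "u \<in> pOmega A" "v \<in> pOmega A"
    and "\<And>F. finite F \<Longrightarrow> \<exists>u' v'. u' \<approx> v' \<and> agree F u u' \<and> agree F v v'"
  shows "u \<approx> v"
proof -
  have "(u, v) \<in> pair_closure A {(u, v). u \<approx> v}"
    using assms unfolding pair_closure_def by fast
  then show ?thesis using eqv_closed by blast
qed

lemma absorb_right_ppow:
  assumes "e \<in> pOmega A" "x \<in> pOmega A" "e \<cdot> x \<approx> e"
  shows "e \<cdot> ppow A x n \<approx> e"
proof (induction n)
  case (Suc n)
  have "e \<cdot> ppow A x (Suc n) = (e \<cdot> ppow A x n) \<cdot> x"
    using assms by (simp add: pmult_assoc)
  also have "\<dots> \<approx> e \<cdot> x" using Suc assms by (intro eqv_right)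
  also have "\<dots> \<approx> e" by fact
  finally show ?case .
qed (use assms eqv_refl in simp)

lemma absorb_left_ppow:
  assumes "e \<in> pOmega A" "x \<in> pOmega A" "x \<cdot> e \<approx> e"
  shows "ppow A x n \<cdot> e \<approx> e"
proof (induction n)
  case (Suc n)
  have "ppow A x (Suc n) \<cdot> e = ppow A x n \<cdot> (x \<cdot> e)"
    using assms by (simp add: pmult_assoc)
  also have "\<dots> \<approx> ppow A x n \<cdot> e" using assms by (intro eqv_left) auto
  also have "\<dots> \<approx> e" by fact
  finally show ?case .
qed (use assms eqv_refl in simp)

lemma absorb_right_pomega:
  assumes "e \<in> pOmega A" "x \<in> pOmega A" "e \<cdot> x \<approx> e"
  shows "e \<cdot> pomega A x \<approx> e"
proof (rule eqv_limit)
  fix F :: "(nat monoid \<times> ('a \<Rightarrow> nat)) set" assume "finite F"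
  then obtain n where "agree F (ppow A x (fact n)) (pomega A x)"
    using pomega_agree2[OF assms(2,2)] by blast
  then have "agree F (e \<cdot> pomega A x) (e \<cdot> ppow A x (fact n))"
    by (intro agree_pmult agree_sym[of F _ "pomega A x"]) auto
  then show "\<exists>u' v'. u' \<approx> v' \<and> agree F (e \<cdot> pomega A x) u' \<and> agree F e v'"
    using absorb_right_ppow[OF assms] agree_refl by blast
qed (use assms in auto)

lemma absorb_left_pomega:
  assumes "e \<in> pOmega A" "x \<in> pOmega A" "x \<cdot> e \<approx> e"
  shows "pomega A x \<cdot> e \<approx> e"
proof (rule eqv_limit)
  fix F :: "(nat monoid \<times> ('a \<Rightarrow> nat)) set" assume "finite F"
  then obtain n where "agree F (ppow A x (fact n)) (pomega A x)"
    using pomega_agree2[OF assms(2,2)] by blast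
  then have "agree F (pomega A x \<cdot> e) (ppow A x (fact n) \<cdot> e)"
    by (intro agree_pmult agree_sym[of F _ "pomega A x"]) auto
  then show "\<exists>u' v'. u' \<approx> v' \<and> agree F (pomega A x \<cdot> e) u' \<and> agree F e v'"
    using absorb_left_ppow[OF assms] agree_refl by blast
qed (use assms in auto)

lemma absorb_right_pword:
  assumes "e \<in> pOmega A" "x \<in> lists B" "B \<subseteq> A" "\<And>b. b \<in> B \<Longrightarrow> e \<cdot> pgen A b \<approx> e"
  shows "e \<cdot> pword A x \<approx> e"
  using assms(2)
proof (induction x)
  case (Cons b x)
  then have *: "b \<in> B" "b \<in> A" "pword A x \<in> pOmega A"
    using assms(3) lists_mono[of B A] by auto
  have "e \<cdot> pword A (b # x) = e \<cdot> pgen A b \<cdot> pword A x"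
    using * assms(1) by (simp add: pmult_assoc)
  also have "\<dots> \<approx> e \<cdot> pword A x"
    using * assms(4) by (intro eqv_right)
  also have "\<dots> \<approx> e" using Cons by simp
  finally show ?case .
qed (use assms eqv_refl in simp)

lemma absorb_left_pword:
  assumes "e \<in> pOmega A" "x \<in> lists B" "B \<subseteq> A" "\<And>b. b \<in> B \<Longrightarrow> pgen A b \<cdot> e \<approx> e"
  shows "pword A x \<cdot> e \<approx> e"
  using assms(2)
proof (induction x)
  case (Cons b x)
  then have *: "b \<in> B" "b \<in> A" "pword A x \<in> pOmega A"
    using assms(3) lists_mono[of B A] by auto
  have "pword A (b # x) \<cdot> e = pgen A b \<cdot> (pword A x \<cdot> e)"
    using * assms(1) by (simp add: pmult_assoc)
  also have "\<dots> \<approx> pgen A b \<cdot> e"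
    using * Cons by (intro eqv_left) auto
  also have "\<dots> \<approx> e" using * assms(4) by simp
  finally show ?case .
qed (use assms eqv_refl in simp)

text \<open>\<open>w\<close> is a limit of words over its own content, and \<open>e\<close> absorbs
  such words letter by letter.\<close>

lemma absorb_right:
  assumes "e \<in> pOmega A" "w \<in> pOmega A" "\<And>b. b \<in> content A w \<Longrightarrow> e \<cdot> pgen A b \<approx> e"
  shows "e \<cdot> w \<approx> e"
proof (rule eqv_limit)
  fix F :: "(nat monoid \<times> ('a \<Rightarrow> nat)) set" assume "finite F"
  with finite_alphabet assms(2)
  obtain x where x: "x \<in> lists (content A w)" "agree F w (pword A x)"
    by (rule content_word_density)
  have "e \<cdot> pword A x \<approx> e"
    using assms(1) x(1) content_subset[OF finite_alphabet assms(2)] assms(3)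
    by (rule absorb_right_pword)
  moreover have "agree F (e \<cdot> w) (e \<cdot> pword A x)"
    using x(2) by (simp add: agree_pmult)
  ultimately show "\<exists>u' v'. u' \<approx> v' \<and> agree F (e \<cdot> w) u' \<and> agree F e v'"
    using agree_refl by blast
qed (use assms in auto)

lemma absorb_left:
  assumes "e \<in> pOmega A" "w \<in> pOmega A" "\<And>b. b \<in> content A w \<Longrightarrow> pgen A b \<cdot> e \<approx> e"
  shows "w \<cdot> e \<approx> e"
proof (rule eqv_limit)
  fix F :: "(nat monoid \<times> ('a \<Rightarrow> nat)) set" assume "finite F"
  with finite_alphabet assms(2)
  obtain x where x: "x \<in> lists (content A w)" "agree F w (pword A x)"
    by (rule content_word_density)
  have "pword A x \<cdot> e \<approx> e"
    using assms(1) x(1) content_subset[OF finite_alphabet assms(2)] assms(3)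
    by (rule absorb_left_pword)
  moreover have "agree F (w \<cdot> e) (pword A x \<cdot> e)"
    using x(2) by (simp add: agree_pmult)
  ultimately show "\<exists>u' v'. u' \<approx> v' \<and> agree F (w \<cdot> e) u' \<and> agree F e v'"
    using agree_refl by blast
qed (use assms in auto)

end

section \<open>Products of letters and stars\<close>

text \<open>Over a finite alphabet the finite products of such languages are the nonempty directed
  downsets of the subword order.\<close>

datatype 'a atom = Letter 'a | Star "'a set"

fun atom_lang :: "'a atom \<Rightarrow> 'a list set" where
  "atom_lang (Letter a) = {[], [a]}"
| "atom_lang (Star B) = lists B"

text \<open>The enumeration of \<open>B\<close> is arbitrary: up to a congruence satisfying the
  Gamma equations, the power depends only on the set of letters, see
  \<open>full_pomega_unique\<close>.\<close>

fun atom_val :: "'a set \<Rightarrow> 'a atom \<Rightarrow> 'a iop" where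
  "atom_val A (Letter a) = pgen A a"
| "atom_val A (Star B) = pomega A (pword A (SOME xs. set xs = B))"

text \<open>With stars nonempty, every atom contributes a letter, so that only the empty product has
  the language of the unit, and no star lies inside a letter language.\<close>

fun wf_atom :: "'a set \<Rightarrow> 'a atom \<Rightarrow> bool" where
  "wf_atom A (Letter a) \<longleftrightarrow> a \<in> A"
| "wf_atom A (Star B) \<longleftrightarrow> B \<subseteq> A \<and> B \<noteq> {}"

definition lang :: "'a atom list \<Rightarrow> 'a list set" where
  "lang ps = foldr (\<lambda>p. conc (atom_lang p)) ps {[]}"

definition val :: "'a set \<Rightarrow> 'a atom list \<Rightarrow> 'a iop" where
  "val A ps = foldr (\<lambda>p. pmult A (atom_val A p)) ps (pone A)"

lemma lang_simps [simp]: "lang [] = {[]}" "lang (p # ps) = conc (atom_lang p) (lang ps)"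
  by (simp_all add: lang_def)

lemma val_simps [simp]: "val A [] = pone A" "val A (p # ps) = pmult A (atom_val A p) (val A ps)"
  by (simp_all add: val_def)

lemma conc_assoc: "conc (conc X Y) Z = conc X (conc Y Z)"
proof (rule Set.set_eqI)
  fix w
  have "w \<in> conc (conc X Y) Z \<longleftrightarrow> (\<exists>x\<in>X. \<exists>y\<in>Y. \<exists>z\<in>Z. w = x @ y @ z)"
    unfolding conc_def by (simp, metis append_assoc)
  also have "\<dots> \<longleftrightarrow> w \<in> conc X (conc Y Z)"
    unfolding conc_def by (simp, metis)
  finally show "w \<in> conc (conc X Y) Z \<longleftrightarrow> w \<in> conc X (conc Y Z)" .
qed

lemma lang_ConsE:
  assumes "w \<in> lang (p # ps)"
  obtains x y where "w = x @ y" "x \<in> atom_lang p" "y \<in> lang ps"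
  using assms unfolding lang_simps by (rule concE)

lemma lang_append: "lang (ps @ qs) = conc (lang ps) (lang qs)"
  by (induction ps) (simp_all add: conc_assoc)

lemma set_some_list: "finite B \<Longrightarrow> set (SOME xs. set xs = B) = B"
  by (rule someI_ex[of "\<lambda>xs. set xs = B"]) (rule finite_list)

lemma star_word_in_lists:
  assumes "finite A" "B \<subseteq> A"
  shows "(SOME xs. set xs = B) \<in> lists A"
  using set_some_list[of B] assms finite_subset[of B A] by auto

lemma atom_val_closed: "finite A \<Longrightarrow> wf_atom A p \<Longrightarrow> atom_val A p \<in> pOmega A"
  by (cases p) (simp_all add: star_word_in_lists pomega_closed pword_closed)

lemma val_closed: "finite A \<Longrightarrow> \<forall>p\<in>set ps. wf_atom A p \<Longrightarrow> val A ps \<in> pOmega A"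
  by (induction ps) (auto simp: atom_val_closed)

lemma val_append:
  assumes "finite A" "\<forall>p\<in>set ps. wf_atom A p" "\<forall>p\<in>set qs. wf_atom A p"
  shows "val A (ps @ qs) = pmult A (val A ps) (val A qs)"
  using assms(2) by (induction ps) (use assms(1,3) in \<open>auto simp: pmult_assoc val_closed atom_val_closed\<close>)

section \<open>Comparing the languages of products\<close>

lemma Nil_in_atom_lang: "[] \<in> atom_lang p"
  by (cases p) auto

lemma atom_lang_nontrivial: "wf_atom A p \<Longrightarrow> \<exists>a. [a] \<in> atom_lang p"
  by (cases p) auto

lemma lang_mono: "lang ps \<subseteq> lang (p # ps)"
proof
  show "w \<in> lang (p # ps)" if "w \<in> lang ps" for w
    using concI[OF Nil_in_atom_lang that] by simp
qed

lemma Nil_in_lang: "[] \<in> lang ps"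
  by (induction ps) (use lang_mono in auto)

lemma lang_tail: "c # w \<in> lang ps \<Longrightarrow> w \<in> lang ps"
proof (induction ps arbitrary: c w)
  case (Cons p ps)
  then obtain x y where xy: "c # w = x @ y" "x \<in> atom_lang p" "y \<in> lang ps"
    by (blast elim: lang_ConsE)
  show ?case
  proof (cases x)
    case Nil
    then have "w \<in> lang ps" using xy Cons.IH by auto
    then show ?thesis using lang_mono by blast
  next
    case (Cons d x')
    then have "x' \<in> atom_lang p" using xy(2) by (cases p) auto
    then show ?thesis using Cons xy by (auto intro: concI)
  qed
qed simp

lemma lang_skip_atom:
  assumes "c # w \<in> lang (p # ps)" "[c] \<notin> atom_lang p"
  shows "c # w \<in> lang ps"
proof -
  obtain x y where xy: "c # w = x @ y" "x \<in> atom_lang p" "y \<in> lang ps"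
    using assms(1) by (rule lang_ConsE)
  have "x = []"
    using xy(1,2) assms(2) by (cases p; cases x) auto
  then show ?thesis using xy by simp
qed

text \<open>\<open>Letter b\<close> accounts for at most the first letter. If it accounts for none,
  \<open>w\<close> remains available because the languages are closed under dropping the first
  letter.\<close>

lemma lang_skip_letter:
  assumes "c # w \<in> lang (Letter b # ps)"
  shows "w \<in> lang ps"
proof (cases "b = c")
  case True
  obtain x y where xy: "c # w = x @ y" "x \<in> atom_lang (Letter b)" "y \<in> lang ps"
    using assms by (rule lang_ConsE)
  then have "w = y \<or> c # w = y" by auto
  then show ?thesis using xy(3) lang_tail[of c w ps] by auto
qed (use lang_tail[of c w ps] lang_skip_atom[OF assms] in auto)

lemma star_Cons:
  assumes "c \<in> B" "w \<in> lang (Star B # ps)"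
  shows "c # w \<in> lang (Star B # ps)"
proof -
  obtain x y where "w = x @ y" "x \<in> atom_lang (Star B)" "y \<in> lang ps"
    using assms(2) by (rule lang_ConsE)
  then show ?thesis
    using assms(1) concI[of "c # x" "lists B" y "lang ps"] by simp
qed

text \<open>Put in front of the word, or keep there, a letter that \<open>p\<close> supplies and
  that uses up or blocks \<open>q\<close>. The extended word is still in the left language, hence in
  the right one, where what was to be shown is left to \<open>qs\<close>.\<close>

lemma lang_subset_skip:
  assumes "\<not> atom_lang p \<subseteq> atom_lang q" "lang (p # ps) \<subseteq> lang (q # qs)"
  shows "lang (p # ps) \<subseteq> lang qs"
proof
  fix w assume w: "w \<in> lang (p # ps)"
  show "w \<in> lang qs"
  proof (cases p)
    case (Letter a)
    then have a: "[a] \<notin> atom_lang q" using assms(1) Nil_in_atom_lang[of q] by auto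
    obtain x w' where x: "w = x @ w'" "x \<in> atom_lang p" "w' \<in> lang ps"
      using w by (rule lang_ConsE)
    then have w': "w' \<in> lang ps" "w = w' \<or> w = a # w'"
      using Letter by auto
    have "a # w' \<in> lang (p # ps)"
      using concI[of "[a]" "{[], [a]}" w' "lang ps"] w' Letter by simp
    then have "a # w' \<in> lang qs"
      using assms(2) a lang_skip_atom[of a w' q qs] by blast
    then show ?thesis using w'(2) lang_tail[of a w' qs] by auto
  next
    case (Star C)
    show ?thesis
    proof (cases q)
      case (Letter b)
      \<comment> \<open>Any \<open>c\<close> in \<open>C\<close> works, even \<open>c = b\<close>:
        \<open>Letter b\<close> can absorb only the added copy, which leaves all of \<open>w\<close>
        to \<open>qs\<close>.\<close>
      have "C \<noteq> {}" using Star assms(1) Nil_in_atom_lang[of q] by auto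
      then obtain c where "c \<in> C" by blast
      then have "c # w \<in> lang (q # qs)"
        using star_Cons[of c C w ps] w Star assms(2) by blast
      then show ?thesis using Letter lang_skip_letter[of c w b qs] by simp
    next
      case (Star B)
      then have "\<not> C \<subseteq> B" using assms(1) \<open>p = Star C\<close> by auto
      then obtain c where c: "c \<in> C" "c \<notin> B" by blast
      then have "c # w \<in> lang (q # qs)"
        using star_Cons[of c C w ps] w \<open>p = Star C\<close> assms(2) by blast
      then have "c # w \<in> lang qs"
        using c Star lang_skip_atom[of c w q qs] by simp
      then show ?thesis by (rule lang_tail)
    qed
  qed
qed

lemma lang_star_absorb:
  assumes "atom_lang p \<subseteq> lists B"
  shows "lang (Star B # p # ps) = lang (Star B # ps)"
proof -
  have "conc (lists B) (atom_lang p) = lists B"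
  proof
    show "conc (lists B) (atom_lang p) \<subseteq> lists B"
    proof
      fix w assume "w \<in> conc (lists B) (atom_lang p)"
      then obtain x y where "w = x @ y" "x \<in> lists B" "y \<in> atom_lang p"
        by (rule concE)
      then show "w \<in> lists B" using subsetD[OF assms, of y] by simp
    qed
    show "lists B \<subseteq> conc (lists B) (atom_lang p)"
    proof
      show "w \<in> conc (lists B) (atom_lang p)" if "w \<in> lists B" for w
        using concI[OF that Nil_in_atom_lang] by simp
    qed
  qed
  then show ?thesis by (simp add: conc_assoc[symmetric])
qed

lemma atom_lang_inject:
  assumes "wf_atom A p" "wf_atom A q" "atom_lang p = atom_lang q"
  shows "p = q"
proof -
  have ne: False if "lists B = {[], [a]}" "B \<noteq> {}" for B :: "'a set" and a
  proof -
    obtain b where "b \<in> B" using \<open>B \<noteq> {}\<close> by blast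
    then have "[b, b] \<in> lists B" by simp
    then show False unfolding \<open>lists B = _\<close> by simp
  qed
  have stars: "B = C" if "lists B = lists C" for B C :: "'a set"
  proof -
    have "[b] \<in> lists B \<longleftrightarrow> [b] \<in> lists C" for b by (simp only: that)
    then show ?thesis by (intro Set.set_eqI) simp
  qed
  show ?thesis
  proof (cases p)
    case (Letter a)
    show ?thesis
    proof (cases q)
      case (Letter b)
      with assms(3) \<open>p = Letter a\<close> show ?thesis by (simp add: doubleton_eq_iff)
    next
      case (Star C)
      with assms(2,3) \<open>p = Letter a\<close> ne[of C a] show ?thesis by simp
    qed
  next
    case (Star B)
    show ?thesis
    proof (cases q)
      case (Letter b)
      with assms(1,3) \<open>p = Star B\<close> ne[of B b] show ?thesis by simp
    next
      case (Star C)
      with assms(3) \<open>p = Star B\<close> stars[of B C] show ?thesis by simp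
    qed
  qed
qed

lemma atom_subset_letter:
  assumes "wf_atom A p" "wf_atom A (Letter b)" "atom_lang p \<subseteq> atom_lang (Letter b)"
  shows "p = Letter b"
proof (cases p)
  case (Star C)
  then obtain c where "c \<in> C" using assms(1) by auto
  then have "[c, c] \<in> atom_lang p" using Star by simp
  then show ?thesis using assms(3) by auto
qed (use assms(3) in auto)

section \<open>Normal forms\<close>

locale gamma_congruence = closed_congruence +
  assumes gamma_right: "x \<in> pOmega A \<Longrightarrow> y \<in> pOmega A \<Longrightarrow>
      pomega A (x \<cdot> y) \<cdot> x \<approx> pomega A (x \<cdot> y)"
    and gamma_left: "x \<in> pOmega A \<Longrightarrow> y \<in> pOmega A \<Longrightarrow>
      y \<cdot> pomega A (x \<cdot> y) \<approx> pomega A (x \<cdot> y)"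
begin

text \<open>The Gamma equations are applied to the splittings p | cq and pc | q of \<open>z\<close>.
  On the right the power absorbs \<open>p\<close> and pc, hence \<open>c\<close>; on the left it
  absorbs \<open>q\<close> and cq, hence \<open>c\<close> again.\<close>

lemma pomega_absorbs_factor:
  assumes "p \<in> pOmega A" "c \<in> pOmega A" "q \<in> pOmega A" "z = p \<cdot> (c \<cdot> q)"
  shows "pomega A z \<cdot> c \<approx> pomega A z" "c \<cdot> pomega A z \<approx> pomega A z"
proof -
  have z: "z \<in> pOmega A" "z = p \<cdot> c \<cdot> q"
    using assms by (auto simp: pmult_assoc)
  have "pomega A z \<cdot> p \<approx> pomega A z"
    using gamma_right[of p "c \<cdot> q"] assms by simp
  then have "pomega A z \<cdot> p \<cdot> c \<approx> pomega A z \<cdot> c"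
    using assms by (intro eqv_right)
  then have "pomega A z \<cdot> c \<approx> pomega A z \<cdot> p \<cdot> c"
    by (rule eqv_sym)
  also have "pomega A z \<cdot> p \<cdot> c = pomega A z \<cdot> (p \<cdot> c)"
    using assms z by (simp add: pmult_assoc)
  also have "pomega A z \<cdot> (p \<cdot> c) \<approx> pomega A z"
    using gamma_right[of "p \<cdot> c" q] assms z(2) by simp
  finally show "pomega A z \<cdot> c \<approx> pomega A z" .
  have "q \<cdot> pomega A z \<approx> pomega A z"
    using gamma_left[of "p \<cdot> c" q] assms z(2) by simp
  then have "c \<cdot> (q \<cdot> pomega A z) \<approx> c \<cdot> pomega A z"
    using assms by (intro eqv_left)
  then have "c \<cdot> pomega A z \<approx> c \<cdot> (q \<cdot> pomega A z)"
    by (rule eqv_sym)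
  also have "c \<cdot> (q \<cdot> pomega A z) = c \<cdot> q \<cdot> pomega A z"
    using assms z by (simp add: pmult_assoc)
  also have "c \<cdot> q \<cdot> pomega A z \<approx> pomega A z"
    using gamma_left[of p "c \<cdot> q"] assms by simp
  finally show "c \<cdot> pomega A z \<approx> pomega A z" .
qed

text \<open>Occurrence of a letter is expressed by an explicit factorization since
  \<open>pomega_absorbs_factor\<close> consumes one.\<close>

definition full :: "'a set \<Rightarrow> 'a iop \<Rightarrow> bool" where
  "full B z \<longleftrightarrow> z \<in> pOmega A \<and> content A z \<subseteq> B \<and>
     (\<forall>b\<in>B. \<exists>p\<in>pOmega A. \<exists>q\<in>pOmega A. z = p \<cdot> (pgen A b \<cdot> q))"

lemma full_pword:
  assumes "set xs = B" "B \<subseteq> A"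
  shows "full B (pword A xs)"
  unfolding full_def
proof (intro conjI ballI)
  have xs: "xs \<in> lists A" using assms by auto
  then show "pword A xs \<in> pOmega A" by simp
  show "content A (pword A xs) \<subseteq> B"
    using assms xs finite_alphabet by (auto simp: content_def subwords_pword subseq_singleton_left)
  fix b assume "b \<in> B"
  then obtain ys zs where "xs = ys @ b # zs"
    using assms(1) by (metis split_list)
  then have "pword A xs = pword A ys \<cdot> (pgen A b \<cdot> pword A zs)"
    "pword A ys \<in> pOmega A" "pword A zs \<in> pOmega A"
    using xs by (auto simp: pword_append)
  then show "\<exists>p\<in>pOmega A. \<exists>q\<in>pOmega A. pword A xs = p \<cdot> (pgen A b \<cdot> q)"
    by blast
qed

lemma full_closed: "full B z \<Longrightarrow> z \<in> pOmega A"
  by (simp add: full_def)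

lemma full_absorbs:
  assumes "full B z" "B \<subseteq> A" "w \<in> pOmega A" "content A w \<subseteq> B"
  shows "pomega A z \<cdot> w \<approx> pomega A z" "w \<cdot> pomega A z \<approx> pomega A z"
proof -
  have z: "pomega A z \<in> pOmega A"
    using assms full_closed by auto
  have "pomega A z \<cdot> pgen A b \<approx> pomega A z \<and> pgen A b \<cdot> pomega A z \<approx> pomega A z" if b: "b \<in> B" for b
  proof -
    obtain p q where "p \<in> pOmega A" "q \<in> pOmega A" "z = p \<cdot> (pgen A b \<cdot> q)"
      using assms(1) b unfolding full_def by blast
    moreover have "pgen A b \<in> pOmega A" using b assms(2) by auto
    ultimately show ?thesis
      using pomega_absorbs_factor[of p "pgen A b" q z] by simp
  qed
  then show "pomega A z \<cdot> w \<approx> pomega A z" "w \<cdot> pomega A z \<approx> pomega A z"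
    using absorb_right[OF z assms(3)] absorb_left[OF z assms(3)] assms(4) by (simp_all add: subset_iff)
qed

text \<open>The product of the two powers reduces to its left factor, which absorbs
  \<open>z\<close>, and to its right factor, which absorbs \<open>y\<close>.\<close>

lemma full_pomega_unique:
  assumes "full B y" "full B z" "B \<subseteq> A"
  shows "pomega A y \<approx> pomega A z"
proof -
  have y: "y \<in> pOmega A" "content A y \<subseteq> B" and z: "z \<in> pOmega A" "content A z \<subseteq> B"
    using assms by (auto simp: full_def)
  have "pomega A y \<cdot> pomega A z \<approx> pomega A y"
    using absorb_right_pomega[of "pomega A y" z] full_absorbs(1)[OF assms(1,3) z] y z by simp
  then have "pomega A y \<approx> pomega A y \<cdot> pomega A z"
    by (rule eqv_sym)
  also have "pomega A y \<cdot> pomega A z \<approx> pomega A z"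
    using absorb_left_pomega[of "pomega A z" y] full_absorbs(2)[OF assms(2,3) y] y z by simp
  finally show ?thesis .
qed

lemma full_extend:
  assumes "full B z" "w \<in> pOmega A" "content A w \<subseteq> B" "B \<subseteq> A"
  shows "full B (z \<cdot> w)"
  unfolding full_def
proof (intro conjI ballI)
  have z: "z \<in> pOmega A" using assms by (simp add: full_def)
  show "z \<cdot> w \<in> pOmega A" using z assms(2) by simp
  show "content A (z \<cdot> w) \<subseteq> B"
    using assms(1,3) content_pmult[OF finite_alphabet z assms(2)] by (simp add: full_def)
  fix b assume b: "b \<in> B"
  then obtain p q where pq: "p \<in> pOmega A" "q \<in> pOmega A" "z = p \<cdot> (pgen A b \<cdot> q)"
    using assms(1) unfolding full_def by blast
  moreover have "pgen A b \<in> pOmega A"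
    using b assms(4) by blast
  ultimately have "z \<cdot> w = p \<cdot> (pgen A b \<cdot> (q \<cdot> w))"
    using assms(2) by (simp add: pmult_assoc)
  moreover have "q \<cdot> w \<in> pOmega A"
    using pq assms(2) by simp
  ultimately show "\<exists>p\<in>pOmega A. \<exists>q\<in>pOmega A. z \<cdot> w = p \<cdot> (pgen A b \<cdot> q)"
    using pq by blast
qed

text \<open>The language is recorded for \<open>u\<close> itself, together with the normal form, so
  it can be computed along the factorizations of \<open>u\<close> without asking whether the
  congruence preserves subwords.\<close>

definition good :: "'a iop \<Rightarrow> bool" where
  "good u \<longleftrightarrow> (\<exists>ps. (\<forall>p\<in>set ps. wf_atom A p) \<and> u \<approx> val A ps \<and> subwords A u = lang ps)"

lemma good_pmult:
  assumes "good u" "good v" "u \<in> pOmega A" "v \<in> pOmega A"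
  shows "good (u \<cdot> v)"
proof -
  obtain ps where ps: "\<forall>p\<in>set ps. wf_atom A p" "u \<approx> val A ps" "subwords A u = lang ps"
    using assms(1) unfolding good_def by blast
  obtain qs where qs: "\<forall>p\<in>set qs. wf_atom A p" "v \<approx> val A qs" "subwords A v = lang qs"
    using assms(2) unfolding good_def by blast
  have "u \<cdot> v \<approx> val A ps \<cdot> v" using ps(2) assms by (intro eqv_right)
  also have "val A ps \<cdot> v \<approx> val A ps \<cdot> val A qs"
    using qs(2) val_closed[OF finite_alphabet ps(1)] by (intro eqv_left)
  also have "val A ps \<cdot> val A qs = val A (ps @ qs)"
    using val_append[OF finite_alphabet ps(1) qs(1)] by simp
  finally have "u \<cdot> v \<approx> val A (ps @ qs)" .
  moreover have "subwords A (u \<cdot> v) = lang (ps @ qs)"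
    using ps(3) qs(3) subwords_pmult[OF finite_alphabet assms(3,4)] by (simp add: lang_append)
  moreover have "\<forall>p\<in>set (ps @ qs). wf_atom A p" using ps(1) qs(1) by auto
  ultimately show ?thesis unfolding good_def by blast
qed

lemma good_pgen: "a \<in> A \<Longrightarrow> good (pgen A a)"
  unfolding good_def using finite_alphabet eqv_refl
  by (intro exI[of _ "[Letter a]"]) (simp add: subwords_pgen)

lemma good_empty_content:
  assumes "u \<in> pOmega A" "content A u = {}"
  shows "good u"
proof -
  \<comment> \<open>Without letters in \<open>u\<close>, the absorption hypothesis holds vacuously
    even for the unit.\<close>
  have "pone A \<cdot> u \<approx> pone A"
    by (rule absorb_right) (use assms in auto)
  then have "u \<approx> val A []" using assms by simp
  moreover have "subwords A u = {[]}"
    using subwords_subset_lists[OF finite_alphabet assms(1)] Nil_in_subwords[OF finite_alphabet assms(1)]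
      assms(2) by auto
  ultimately show ?thesis
    unfolding good_def by (intro exI[of _ "[]"]) simp
qed

text \<open>An element that splits into arbitrarily many full factors agrees, at any finite set of
evaluation points, with one of the form \<open>s \<cdot> y\<^sup>\<omega> \<cdot> r\<close>: two of its
prefixes must take the same values there.\<close>

lemma infinite_factorization:
  assumes B: "B \<subseteq> A" and E: "full B e"
    and r: "\<And>n. r n \<in> pOmega A" "\<And>n. content A (r n) \<subseteq> B"
    and z: "\<And>n. full B (z n)" "\<And>n. r n = z n \<cdot> r (Suc n)"
  shows "r 0 \<approx> pomega A e"
proof (rule eqv_limit)
  fix F :: "(nat monoid \<times> ('a \<Rightarrow> nat)) set" assume F: "finite F"
  define G where "G = {(T, e) \<in> F. admissible A T e}"
  have G: "finite G" "\<And>T e. (T, e) \<in> G \<Longrightarrow> admissible A T e"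
    unfolding G_def using F by (auto intro: finite_subset)
  have zc: "z n \<in> pOmega A" "content A (z n) \<subseteq> B" for n
    using z(1)[of n] by (auto simp: full_def)
  \<comment> \<open>The prefix consisting of the first n factors \<open>z\<close>; its remainder is
    \<open>r n\<close>.\<close>
  define s where "s = rec_nat (pone A) (\<lambda>n x. x \<cdot> z n)"
  have s_simps: "s 0 = pone A" "s (Suc n) = s n \<cdot> z n" for n
    by (simp_all add: s_def)
  have s: "s n \<in> pOmega A \<and> content A (s n) \<subseteq> B" for n
  proof (induction n)
    case 0
    then show ?case using finite_alphabet by (simp add: s_simps content_def subwords_pone)
  next
    case (Suc n)
    then show ?case using zc[of n] finite_alphabet by (simp add: s_simps content_pmult)
  qed
  have r0: "r 0 = s n \<cdot> r n" for n
  proof (induction n)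
    case (Suc n)
    then show ?case using s zc r(1) z(2)[of n] by (simp add: s_simps pmult_assoc)
  qed (use r in \<open>simp add: s_simps\<close>)
  have seg: "\<exists>y. full B y \<and> s (i + Suc k) = s i \<cdot> y" for i k
  proof (induction k)
    case 0
    then show ?case using z(1) s_simps by auto
  next
    case (Suc k)
    then obtain y where y: "full B y" "s (i + Suc k) = s i \<cdot> y" by blast
    then have "full B (y \<cdot> z (i + Suc k))"
      using zc B by (intro full_extend)
    moreover have "s (i + Suc (Suc k)) = s i \<cdot> (y \<cdot> z (i + Suc k))"
      using y zc s full_closed[OF y(1)] by (simp add: s_simps pmult_assoc)
    ultimately show ?case by blast
  qed
  define g where "g = (\<lambda>n. \<lambda>(T, e)\<in>G. s n T e)"
  have "g n \<in> (\<Pi>\<^sub>E p\<in>G. carrier (fst p))" for n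
  proof (rule PiE_I)
    fix p assume p: "p \<in> G"
    obtain T e where "p = (T, e)" by (cases p)
    then show "g n p \<in> carrier (fst p)"
      using p G(2) pOmega_carrier[of "s n" A T e] s[of n] by (simp add: g_def)
  qed (simp add: g_def)
  then have "range g \<subseteq> (\<Pi>\<^sub>E p\<in>G. carrier (fst p))"
    by auto
  moreover have "finite (\<Pi>\<^sub>E p\<in>G. carrier (fst p))"
    using G by (intro finite_PiE) (auto simp: admissible_def fin_mon_def)
  ultimately have "finite (range g)" by (rule finite_subset)
  then have "\<not> inj g" using finite_imageD infinite_UNIV_nat by blast
  then obtain i j where "i < j" "g i = g j"
    unfolding inj_on_def by (metis linorder_neqE_nat)
  then obtain k where k: "g i = g (i + Suc k)"
    by (metis less_iff_Suc_add add_Suc_right)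
  obtain y where y: "full B y" "s (i + Suc k) = s i \<cdot> y"
    using seg by blast
  have fixed: "s i T e = s i T e \<otimes>\<^bsub>T\<^esub> y T e" if "(T, e) \<in> G" for T e
  proof -
    have "g n (T, e) = s n T e" for n
      using that by (simp add: g_def)
    then have "s i T e = s (i + Suc k) T e"
      using k by metis
    then show ?thesis
      using y(2) G(2)[OF that] by (simp add: pmult_eval)
  qed
  have yc: "y \<in> pOmega A" using y by (simp add: full_def)
  \<comment> \<open>At the given points \<open>s i\<close> is fixed by right multiplication with
    \<open>y\<close>, so any power of \<open>y\<close>, and the limit, may be inserted before
    \<open>r i\<close>.\<close>
  have "agree F (r 0) (s i \<cdot> (pomega A y \<cdot> r i))"
  proof (rule agreeI_admissible[of _ A])
    fix T e assume Te: "(T, e) \<in> F" "admissible A T e"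
    interpret monoid T using Te(2) by (rule admissible_monoid)
    have c: "s i T e \<in> carrier T" "y T e \<in> carrier T" "r i T e \<in> carrier T"
      using s[of i] r(1)[of i] yc Te(2) pOmega_carrier[of _ A T e] by blast+
    have "s i T e \<otimes>\<^bsub>T\<^esub> y T e [^]\<^bsub>T\<^esub> n = s i T e" for n :: nat
    proof (induction n)
      case (Suc n)
      have "s i T e \<otimes>\<^bsub>T\<^esub> y T e [^]\<^bsub>T\<^esub> Suc n = s i T e \<otimes>\<^bsub>T\<^esub> y T e [^]\<^bsub>T\<^esub> n \<otimes>\<^bsub>T\<^esub> y T e"
        using c by (simp add: m_assoc)
      then show ?case using Suc fixed Te by (simp add: G_def)
    qed (use c in simp)
    then have "s i T e \<otimes>\<^bsub>T\<^esub> pomega A y T e = s i T e"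
      using pomega_eval[OF yc Te(2) order_refl] by simp
    moreover have "pomega A y T e \<in> carrier T"
      using pOmega_carrier[OF pomega_closed[OF yc] Te(2)] .
    ultimately have "s i T e \<otimes>\<^bsub>T\<^esub> (pomega A y T e \<otimes>\<^bsub>T\<^esub> r i T e) = s i T e \<otimes>\<^bsub>T\<^esub> r i T e"
      using c by (simp add: m_assoc[symmetric])
    then show "r 0 T e = (s i \<cdot> (pomega A y \<cdot> r i)) T e"
      using r0[of i] Te(2) by (simp add: pmult_eval)
  qed (use r s yc in auto)
  moreover have "s i \<cdot> (pomega A y \<cdot> r i) \<approx> pomega A e"
  proof -
    have "s i \<cdot> (pomega A y \<cdot> r i) \<approx> s i \<cdot> pomega A y"
      using full_absorbs(1)[OF y(1) B r] s by (intro eqv_left) auto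
    also have "s i \<cdot> pomega A y \<approx> pomega A y"
      using full_absorbs(2)[OF y(1) B] s by blast
    also have "pomega A y \<approx> pomega A e"
      using full_pomega_unique[OF y(1) E B] .
    finally show ?thesis .
  qed
  ultimately show "\<exists>u' v'. u' \<approx> v' \<and> agree F (r 0) u' \<and> agree F (pomega A e) v'"
    using agree_refl by blast
qed (use r full_closed[OF E] in auto)

text \<open>A counterexample over a minimal \<open>B\<close> must contain every letter of
  \<open>B\<close>. Cutting it at a first \<open>b\<close> leaves a front of smaller content, which
  is good, so the remainder is again a counterexample. Repeated forever, this yields the factors
  required by \<open>infinite_factorization\<close>, which shows the element to be good after
  all.\<close>

lemma all_good:
  assumes "u \<in> pOmega A"
  shows "good u"
proof -
  have "\<forall>u\<in>pOmega A. content A u \<subseteq> B \<longrightarrow> good u" if "finite B" "B \<subseteq> A" for B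
    using that
  proof (induction B rule: finite_psubset_induct)
    case (psubset B)
    define bad where "bad v \<longleftrightarrow> v \<in> pOmega A \<and> content A v \<subseteq> B \<and> \<not> good v" for v
    have split: "\<exists>v' v''. v' \<in> pOmega A \<and> content A v' \<subseteq> B \<and> bad v'' \<and> v = v' \<cdot> (pgen A b \<cdot> v'')"
      if v: "bad v" and b: "b \<in> B" for v b
    proof -
      have bA: "b \<in> A" using b psubset.prems by blast
      have v': "v \<in> pOmega A" "content A v \<subseteq> B" "\<not> good v"
        using v by (auto simp: bad_def)
      have small: "good w" if "w \<in> pOmega A" "content A w \<subset> B" for w
        using psubset.IH[OF that(2)] that psubset.prems by blast
      have bv: "b \<in> content A v"
        using small[OF v'(1)] v' b by blast
      obtain v1 v2 where f: "v1 \<in> pOmega A" "v2 \<in> pOmega A" "b \<notin> content A v1"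
        "v = v1 \<cdot> (pgen A b \<cdot> v2)"
        using finite_alphabet v'(1) bv by (rule first_occurrence)
      have "content A v = content A v1 \<union> ({b} \<union> content A v2)"
        using f bA finite_alphabet by (simp add: content_pmult content_pgen)
      then have c: "content A v1 \<subset> B" "content A v2 \<subseteq> B"
        using v'(2) f(3) b by auto
      have "\<not> good v2"
        using v'(3) f small[OF f(1) c(1)] good_pgen[OF bA] good_pmult pgen_closed[OF bA] by auto
      then show ?thesis using f c by (auto simp: bad_def)
    qed
    have "False" if u: "bad u" for u
    \<comment> \<open>The empty alphabet is separate because \<open>Star {}\<close> is not
      well-formed.\<close>
    proof (cases "B = {}")
      case True
      then show False using u good_empty_content by (auto simp: bad_def)
    next
      case False
      \<comment> \<open>One cut for each letter of \<open>bs\<close>; the removed pieces together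
        form \<open>z\<close>, in which all these letters occur.\<close>
      have step: "\<exists>z v'. z \<in> pOmega A \<and> content A z \<subseteq> B \<and> bad v' \<and> v = z \<cdot> v' \<and>
          (\<forall>b\<in>set bs. \<exists>p\<in>pOmega A. \<exists>q\<in>pOmega A. z = p \<cdot> (pgen A b \<cdot> q))"
        if "bad v" "set bs \<subseteq> B" for v bs
        using that
      proof (induction bs arbitrary: v)
        case Nil
        have "content A (pone A) = {}"
          using finite_alphabet by (simp add: content_def subwords_pone)
        then show ?case using Nil by (intro exI[of _ "pone A"] exI[of _ v]) (auto simp: bad_def)
      next
        case (Cons b bs)
        have b: "b \<in> B" "b \<in> A" "set bs \<subseteq> B" using Cons.prems psubset.prems by auto
        obtain v1 v2 where v: "v1 \<in> pOmega A" "content A v1 \<subseteq> B" "bad v2"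
          "v = v1 \<cdot> (pgen A b \<cdot> v2)"
          using split[OF Cons.prems(1) b(1)] by blast
        obtain z v3 where z: "z \<in> pOmega A" "content A z \<subseteq> B" "bad v3" "v2 = z \<cdot> v3"
          "\<forall>b\<in>set bs. \<exists>p\<in>pOmega A. \<exists>q\<in>pOmega A. z = p \<cdot> (pgen A b \<cdot> q)"
          using Cons.IH[OF v(3) b(3)] by blast
        have v3: "v3 \<in> pOmega A" using z(3) by (simp add: bad_def)
        have "v = v1 \<cdot> (pgen A b \<cdot> z) \<cdot> v3"
          using v z v3 b(2) by (simp add: pmult_assoc)
        moreover have "content A (v1 \<cdot> (pgen A b \<cdot> z)) \<subseteq> B"
          using v(1,2) z(1,2) b finite_alphabet by (simp add: content_pmult content_pgen)
        moreover have "\<exists>p\<in>pOmega A. \<exists>q\<in>pOmega A. v1 \<cdot> (pgen A b \<cdot> z) = p \<cdot> (pgen A c \<cdot> q)"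
          if "c \<in> set (b # bs)" for c
        proof (cases "c = b")
          case True
          then show ?thesis using v(1) z(1) by blast
        next
          case False
          then have c: "c \<in> set bs" "c \<in> A" using that Cons.prems psubset.prems by auto
          obtain p q where pq: "p \<in> pOmega A" "q \<in> pOmega A" "z = p \<cdot> (pgen A c \<cdot> q)"
            using z(5) c by blast
          then have "v1 \<cdot> (pgen A b \<cdot> z) = v1 \<cdot> (pgen A b \<cdot> p) \<cdot> (pgen A c \<cdot> q)"
            using v(1) b(2) c(2) by (simp add: pmult_assoc)
          moreover have "v1 \<cdot> (pgen A b \<cdot> p) \<in> pOmega A"
            using v(1) b(2) pq(1) by simp
          ultimately show ?thesis using pq(2) by blast
        qed
        ultimately show ?case
          using v(1) z(1,3) b(2) by (intro exI[of _ "v1 \<cdot> (pgen A b \<cdot> z)"] exI[of _ v3]) auto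
      qed
      obtain bs where bs: "set bs = B" using psubset.hyps finite_list by blast
      have full_step: "\<exists>v'. bad v' \<and> (\<exists>z. full B z \<and> v = z \<cdot> v')" if v: "bad v" for v
      proof -
        obtain z v' where "z \<in> pOmega A" "content A z \<subseteq> B" "bad v'" "v = z \<cdot> v'"
          "\<forall>b\<in>set bs. \<exists>p\<in>pOmega A. \<exists>q\<in>pOmega A. z = p \<cdot> (pgen A b \<cdot> q)"
          using step[OF v, of bs] bs by auto
        then show ?thesis unfolding full_def bs by blast
      qed
      obtain r where r: "r 0 = u" "\<And>n. bad (r n)" "\<And>n. \<exists>z. full B z \<and> r n = z \<cdot> r (Suc n)"
        using dependent_nat_choice[of "\<lambda>n v. bad v \<and> (n = 0 \<longrightarrow> v = u)"
            "\<lambda>n v v'. \<exists>z. full B z \<and> v = z \<cdot> v'"] u full_step by auto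
      obtain z where z: "\<And>n. full B (z n)" "\<And>n. r n = z n \<cdot> r (Suc n)"
        using r(3) by metis
      define e where "e = pword A (SOME xs. set xs = B)"
      have e: "full B e"
        unfolding e_def using set_some_list[OF psubset.hyps] psubset.prems by (rule full_pword)
      have "u \<approx> pomega A e"
        using infinite_factorization[of B e r z, OF psubset.prems e _ _ z] r(1,2) by (auto simp: bad_def)
      then have "u \<approx> val A [Star B]"
        using full_closed[OF e] by (simp add: e_def)
      moreover have "subwords A u = lists B"
      proof
        show "subwords A u \<subseteq> lists B"
          using subwords_subset_lists[OF finite_alphabet, of u] u lists_mono[of "content A u" B]
          by (auto simp: bad_def)
        \<comment> \<open>A bad element contains every word over \<open>B\<close>: one cut finds its
          first letter, and the remainder is bad again.\<close>
        have "w \<in> subwords A v" if "w \<in> lists B" "bad v" for w v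
          using that
        proof (induction w arbitrary: v rule: list.induct)
          case Nil
          then show ?case using Nil_in_subwords[OF finite_alphabet] by (simp add: bad_def)
        next
          case (Cons b w)
          then have b: "b \<in> B" "b \<in> A" using psubset.prems by auto
          obtain v1 v2 where v: "v1 \<in> pOmega A" "content A v1 \<subseteq> B" "bad v2"
            "v = v1 \<cdot> (pgen A b \<cdot> v2)"
            using split[OF Cons.prems(2) b(1)] by blast
          have v2: "v2 \<in> pOmega A" "w \<in> subwords A v2"
            using v(3) Cons by (auto simp: bad_def)
          have "[b] @ w \<in> subwords A (pgen A b \<cdot> v2)"
            using v2 b finite_alphabet
              concI[of "[b]" "subwords A (pgen A b)" w] by (simp add: subwords_pmult subwords_pgen)
          then have "[] @ [b] @ w \<in> conc (subwords A v1) (subwords A (pgen A b \<cdot> v2))"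
            using Nil_in_subwords[OF finite_alphabet v(1)] by (intro concI)
          then show ?case
            using v v2 b finite_alphabet by (simp add: subwords_pmult)
        qed
        then show "lists B \<subseteq> subwords A u" using u by blast
      qed
      ultimately have "good u"
        unfolding good_def using False psubset.prems by (intro exI[of _ "[Star B]"]) simp
      then show False using u by (simp add: bad_def)
    qed
    then show ?case by (auto simp: bad_def)
  qed
  then show ?thesis
    using content_subset[OF finite_alphabet assms] finite_alphabet assms by blast
qed

section \<open>The word problem for normal forms\<close>

lemma star_absorbs_atom:
  assumes "wf_atom A p" "wf_atom A (Star B)" "atom_lang p \<subseteq> lists B"
  shows "atom_val A (Star B) \<cdot> atom_val A p \<approx> atom_val A (Star B)"
    and "atom_val A p \<cdot> atom_val A (Star B) \<approx> atom_val A (Star B)"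
proof -
  define e where "e = pword A (SOME xs. set xs = B)"
  have B: "B \<subseteq> A" "finite B"
    using assms(2) finite_alphabet finite_subset by auto
  have e: "full B e"
    unfolding e_def using set_some_list[OF B(2)] B(1) by (rule full_pword)
  have val: "atom_val A (Star B) = pomega A e" by (simp add: e_def)
  have "pomega A e \<cdot> atom_val A p \<approx> pomega A e \<and> atom_val A p \<cdot> pomega A e \<approx> pomega A e"
  proof (cases p)
    case (Letter a)
    then have "a \<in> B" "a \<in> A" using assms(1,3) by auto
    then show ?thesis
      using full_absorbs[OF e B(1), of "pgen A a"] finite_alphabet Letter by (simp add: content_pgen)
  next
    case (Star C)
    define f where "f = pword A (SOME xs. set xs = C)"
    have C: "C \<subseteq> A" "finite C"
      using assms(1) Star finite_alphabet finite_subset by auto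
    have "C \<subseteq> B"
    proof
      fix c assume "c \<in> C"
      then have "[c] \<in> atom_lang p" using Star by simp
      then show "c \<in> B" using subsetD[OF assms(3)] by force
    qed
    moreover have f: "full C f"
      unfolding f_def using set_some_list[OF C(2)] C(1) by (rule full_pword)
    ultimately have "f \<in> pOmega A" "content A f \<subseteq> B" by (auto simp: full_def)
    then show ?thesis
      using full_absorbs[OF e B(1), of f] absorb_left_pomega[of "pomega A e" f]
        absorb_right_pomega[of "pomega A e" f] full_closed[OF e] Star by (simp add: f_def)
  qed
  then show "atom_val A (Star B) \<cdot> atom_val A p \<approx> atom_val A (Star B)"
    "atom_val A p \<cdot> atom_val A (Star B) \<approx> atom_val A (Star B)"
    unfolding val by auto
qed

lemma val_star_absorb:
  assumes "\<forall>q\<in>set (Star B # p # ps). wf_atom A q" "atom_lang p \<subseteq> lists B"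
  shows "val A (Star B # p # ps) \<approx> val A (Star B # ps)"
proof -
  have c: "atom_val A (Star B) \<in> pOmega A" "atom_val A p \<in> pOmega A" "val A ps \<in> pOmega A"
    using assms(1) finite_alphabet by (simp_all add: atom_val_closed val_closed del: atom_val.simps)
  have "val A (Star B # p # ps) = atom_val A (Star B) \<cdot> atom_val A p \<cdot> val A ps"
    using c by (simp add: pmult_assoc del: atom_val.simps)
  also have "\<dots> \<approx> atom_val A (Star B) \<cdot> val A ps"
    using star_absorbs_atom(1)[of p B] assms c by (intro eqv_right) auto
  finally show ?thesis by simp
qed

lemma val_absorb_star:
  assumes "\<forall>q\<in>set (p # Star B # ps). wf_atom A q" "atom_lang p \<subseteq> lists B"
  shows "val A (p # Star B # ps) \<approx> val A (Star B # ps)"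
proof -
  have c: "atom_val A (Star B) \<in> pOmega A" "atom_val A p \<in> pOmega A" "val A ps \<in> pOmega A"
    using assms(1) finite_alphabet by (simp_all add: atom_val_closed val_closed del: atom_val.simps)
  have "val A (p # Star B # ps) = atom_val A p \<cdot> atom_val A (Star B) \<cdot> val A ps"
    using c by (simp add: pmult_assoc del: atom_val.simps)
  also have "\<dots> \<approx> atom_val A (Star B) \<cdot> val A ps"
    using star_absorbs_atom(2)[of p B] assms c by (intro eqv_right) auto
  finally show ?thesis by simp
qed

text \<open>Induction on the total length. Unless the first atoms are equal,
  \<open>lang_subset_skip\<close> shows that a first atom leaves the language unchanged and can be
  removed; equal letters cancel, and equal stars cancel once no following atom fits into
  them.\<close>

lemma lang_eq_imp_val_eqv:
  assumes "\<forall>p\<in>set ps. wf_atom A p" "\<forall>q\<in>set qs. wf_atom A q" "lang ps = lang qs"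
  shows "val A ps \<approx> val A qs"
  using assms
proof (induction "length ps + length qs" arbitrary: ps qs rule: less_induct)
  case less
  have nontrivial: "lang (p # rs) \<noteq> {[]}" if wf_p: "wf_atom A p" for p rs
  proof -
    obtain a where "[a] \<in> atom_lang p" using atom_lang_nontrivial[OF wf_p] by blast
    then have "[a] @ [] \<in> lang (p # rs)"
      using Nil_in_lang[of rs] unfolding lang_simps by (rule concI)
    then show ?thesis by auto
  qed
  note IH = less.hyps
  show ?case
  proof (cases ps)
    case Nil
    then have "qs = []"
      using less.prems nontrivial by (cases qs) auto
    then show ?thesis using Nil eqv_refl by simp
  next
    case (Cons p ps')
    note ps = this
    then obtain q qs' where qs: "qs = q # qs'"
      using less.prems nontrivial[of p ps'] by (cases qs) auto
    have wf: "wf_atom A p" "wf_atom A q" "\<forall>r\<in>set ps'. wf_atom A r" "\<forall>r\<in>set qs'. wf_atom A r"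
      using less.prems ps qs by auto
    have closed: "val A ps' \<in> pOmega A" "val A qs' \<in> pOmega A" "atom_val A p \<in> pOmega A"
      "atom_val A q \<in> pOmega A"
      using wf finite_alphabet by (simp_all add: val_closed atom_val_closed)
    \<comment> \<open>Stated for either assignment of the two products, so that it serves both
      strict inclusions.\<close>
    have absorb: "val A (p1 # rs) \<approx> val A (q1 # ss)"
      if "p1 # rs = ps \<and> q1 # ss = qs \<or> p1 # rs = qs \<and> q1 # ss = ps"
        and sub: "atom_lang p1 \<subseteq> atom_lang q1" "\<not> atom_lang q1 \<subseteq> atom_lang p1" for p1 q1 rs ss
    proof -
      have w: "\<forall>r\<in>set (p1 # rs). wf_atom A r" "\<forall>r\<in>set (q1 # ss). wf_atom A r"
        and l: "lang (p1 # rs) = lang (q1 # ss)"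
        and m: "length rs + length (q1 # ss) < length ps + length qs"
        using that(1) less.prems by auto
      have "lang (q1 # ss) \<subseteq> lang rs"
        using lang_subset_skip[OF sub(2)] l by simp
      then have "lang rs = lang (q1 # ss)"
        using lang_mono[of rs p1] l by blast
      then have "val A rs \<approx> val A (q1 # ss)"
        using w by (intro IH m) auto
      then have "val A (p1 # rs) \<approx> val A (p1 # q1 # ss)"
        using w finite_alphabet eqv_left[of "val A rs" "val A (q1 # ss)" "atom_val A p1"]
        by (simp add: atom_val_closed)
      \<comment> \<open>By \<open>atom_subset_letter\<close> a letter has no smaller well-formed
        atom inside, so the larger atom \<open>q1\<close> is a star and absorbs
        \<open>p1\<close>.\<close>
      also obtain B where B: "q1 = Star B"
        using atom_subset_letter[of A p1] w sub by (cases q1) auto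
      have "val A (p1 # q1 # ss) \<approx> val A (q1 # ss)"
        using val_absorb_star[of p1 B ss] w sub(1) B by simp
      finally show ?thesis .
    qed
    consider (incomparable) "\<not> atom_lang p \<subseteq> atom_lang q" "\<not> atom_lang q \<subseteq> atom_lang p"
      | (less) "atom_lang p \<subseteq> atom_lang q" "\<not> atom_lang q \<subseteq> atom_lang p"
      | (greater) "\<not> atom_lang p \<subseteq> atom_lang q" "atom_lang q \<subseteq> atom_lang p"
      | (equal) "atom_lang p = atom_lang q" by blast
    then show ?thesis
    proof cases
      case incomparable
      \<comment> \<open>Each language fits into the tail of the other product, so all four coincide;
        passing through both tails keeps every comparison shorter than the original.\<close>
      have "lang ps \<subseteq> lang qs'" "lang qs \<subseteq> lang ps'"
        using lang_subset_skip incomparable less.prems(3) unfolding ps qs by blast+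
      moreover have "lang ps' \<subseteq> lang ps" "lang qs' \<subseteq> lang qs"
        using lang_mono ps qs by blast+
      ultimately have l: "lang ps = lang qs'" "lang qs' = lang ps'" "lang ps' = lang qs"
        using less.prems(3) by blast+
      have "val A ps \<approx> val A qs'"
        using less.prems wf ps qs by (intro IH l) auto
      also have "val A qs' \<approx> val A ps'"
        using less.prems wf ps qs by (intro IH l) auto
      also have "val A ps' \<approx> val A qs"
        using less.prems wf ps qs by (intro IH l) auto
      finally show ?thesis .
    next
      case less
      then show ?thesis using absorb[of p ps' q qs'] ps qs by simp
    next
      case greater
      then show ?thesis using eqv_sym[OF absorb[of q qs' p ps']] ps qs by simp
    next
      case equal
      then have pq: "q = p" using atom_lang_inject[OF wf(1,2)] by simp
      have tails: ?thesis if "lang ps' = lang qs'"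
      proof -
        have "val A ps' \<approx> val A qs'"
          using wf ps qs that by (intro IH) auto
        then show ?thesis
          using eqv_left[of "val A ps'" "val A qs'" "atom_val A p"] closed ps qs pq by simp
      qed
      show ?thesis
      proof (cases p)
        case (Letter a)
        have "lang rs \<subseteq> lang ss" if "lang (Letter a # rs) = lang (Letter a # ss)" for rs ss
        proof
          fix w assume "w \<in> lang rs"
          then have "[a] @ w \<in> lang (Letter a # rs)"
            unfolding lang_simps by (intro concI) auto
          then show "w \<in> lang ss"
            using that lang_skip_letter[of a w a ss] by simp
        qed
        then have "lang ps' = lang qs'"
          using less.prems(3) ps qs pq Letter by blast
        then show ?thesis by (rule tails)
      next
        case (Star B)
        \<comment> \<open>An atom inside the preceding star vanishes from both value and language,
          leaving a shorter pair to the induction.\<close>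
        have drop: "val A (Star B # rs) \<approx> val A (Star B # ss)"
          if "Star B # rs = ps \<and> Star B # ss = qs \<or> Star B # rs = qs \<and> Star B # ss = ps"
            and r: "rs = r # rs'" "atom_lang r \<subseteq> lists B" for r rs rs' ss
        proof -
          have w: "\<forall>r\<in>set (Star B # rs). wf_atom A r" "\<forall>r\<in>set (Star B # ss). wf_atom A r"
            and l: "lang (Star B # rs) = lang (Star B # ss)"
            and m: "length (Star B # rs') + length (Star B # ss) < length ps + length qs"
            using that(1) less.prems r(1) by auto
          have "val A (Star B # rs) \<approx> val A (Star B # rs')"
            using val_star_absorb[OF _ r(2)] w(1) unfolding r(1) by blast
          also have "val A (Star B # rs') \<approx> val A (Star B # ss)"
          proof (rule IH[OF m])
            show "lang (Star B # rs') = lang (Star B # ss)"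
              using lang_star_absorb[OF r(2)] l unfolding r(1) by metis
          qed (use w r(1) in auto)
          finally show ?thesis .
        qed
        \<comment> \<open>If the next atom does not fit into the star,
          \<open>lang_subset_skip\<close> strips the star from the other product.\<close>
        have skip: "lang rs \<subseteq> lang ss"
          if "lang (Star B # rs) = lang (Star B # ss)" "\<nexists>r rs'. rs = r # rs' \<and> atom_lang r \<subseteq> lists B"
          for rs ss
        proof (cases rs)
          case Nil
          then show ?thesis using Nil_in_lang by simp
        next
          case (Cons r rs')
          then have "\<not> atom_lang r \<subseteq> atom_lang (Star B)" using that(2) by simp
          moreover have "lang (r # rs') \<subseteq> lang (Star B # ss)"
            using lang_mono[of rs "Star B"] that(1) Cons by metis
          ultimately show ?thesis using lang_subset_skip Cons by blast
        qed
        consider (left) r rs' where "ps' = r # rs'" "atom_lang r \<subseteq> lists B"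
          | (right) r rs' where "qs' = r # rs'" "atom_lang r \<subseteq> lists B"
          | (neither) "\<nexists>r rs'. ps' = r # rs' \<and> atom_lang r \<subseteq> lists B"
            "\<nexists>r rs'. qs' = r # rs' \<and> atom_lang r \<subseteq> lists B" by blast
        then show ?thesis
        proof cases
          case left
          then show ?thesis using drop[of ps' qs'] ps qs pq Star by simp
        next
          case right
          then show ?thesis using eqv_sym[OF drop[of qs' ps']] ps qs pq Star by simp
        next
          case neither
          have "lang (Star B # ps') = lang (Star B # qs')"
            using less.prems(3) ps qs pq Star by simp
          then have "lang ps' = lang qs'"
            using skip[OF _ neither(1)] skip[OF _ neither(2)] by (metis subset_antisym)
          then show ?thesis by (rule tails)
        qed
      qed
    qed
  qed
qed

lemma subwords_eq_imp_eqv: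
  assumes "u \<in> pOmega A" "v \<in> pOmega A" "subwords A u = subwords A v"
  shows "u \<approx> v"
proof -
  obtain ps where ps: "\<forall>p\<in>set ps. wf_atom A p" "u \<approx> val A ps" "subwords A u = lang ps"
    using all_good[OF assms(1)] unfolding good_def by blast
  obtain qs where qs: "\<forall>p\<in>set qs. wf_atom A p" "v \<approx> val A qs" "subwords A v = lang qs"
    using all_good[OF assms(2)] unfolding good_def by blast
  note ps(2)
  also have "val A ps \<approx> val A qs"
    using ps qs assms(3) by (intro lang_eq_imp_val_eqv) auto
  also have "val A qs \<approx> v"
    using qs(2) by (rule eqv_sym)
  finally show ?thesis .
qed

end

section \<open>Ordered monoids in which the unit is the least element\<close>

lemma cont_hom_fin_ppow:
  assumes "cont_hom_fin B T h" "x \<in> pOmega B"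
  shows "h (ppow B x n) = h x [^]\<^bsub>T\<^esub> n"
  using assms by (induction n) (auto simp: cont_hom_fin_def nat_pow_def)

text \<open>Continuity replaces the omega power by a factorial power, chosen so large that it has
  stabilized in \<open>T\<close>.\<close>

lemma cont_hom_fin_pomega:
  assumes "cont_hom_fin B T h" "fin_mon T" "x \<in> pOmega B"
  shows "h (pomega B x) = h x [^]\<^bsub>T\<^esub> (fact (card (carrier T)) :: nat)"
proof -
  have hx: "h x \<in> carrier T"
    using assms(1,3) by (auto simp: cont_hom_fin_def)
  obtain G where G: "finite G" "\<And>w. w \<in> pOmega B \<Longrightarrow> agree G (pomega B x) w \<Longrightarrow> h w = h (pomega B x)"
    using assms(1) pomega_closed[OF assms(3)] unfolding cont_hom_fin_def by metis
  have "\<forall>\<^sub>F n in sequentially. agree G (ppow B x (fact n)) (pomega B x) \<and> card (carrier T) \<le> n"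
    using pomega_agree[OF assms(3) G(1)] by (intro eventually_conj) (auto simp: eventually_sequentially)
  then obtain n where n: "agree G (ppow B x (fact n)) (pomega B x)" "card (carrier T) \<le> n"
    by (auto simp: eventually_sequentially)
  have "h (pomega B x) = h (ppow B x (fact n))"
    using G(2)[OF ppow_closed[OF assms(3)] agree_sym[OF n(1)]] by simp
  also have "\<dots> = h x [^]\<^bsub>T\<^esub> (fact n :: nat)"
    using assms by (intro cont_hom_fin_ppow)
  also have "\<dots> = h x [^]\<^bsub>T\<^esub> (fact (card (carrier T)) :: nat)"
    using assms(2) hx n(2) by (intro finite_monoid_power_fact(1)) (auto simp: fin_mon_def)
  finally show ?thesis .
qed

text \<open>The last two conditions are what compatibility with a least unit gives. Elements
  generating the same two-sided ideal lie below each other, so such monoids are J-trivial.\<close>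

locale unit_least_monoid = monoid T for T :: "nat monoid" (structure) +
  fixes le :: "nat \<Rightarrow> nat \<Rightarrow> bool" (infix "\<sqsubseteq>" 50)
  assumes finite_carrier: "finite (carrier T)"
    and antisym: "x \<in> carrier T \<Longrightarrow> y \<in> carrier T \<Longrightarrow> x \<sqsubseteq> y \<Longrightarrow> y \<sqsubseteq> x \<Longrightarrow> x = y"
    and le_trans: "x \<sqsubseteq> y \<Longrightarrow> y \<sqsubseteq> z \<Longrightarrow> x \<sqsubseteq> z"
    and le_right: "x \<in> carrier T \<Longrightarrow> y \<in> carrier T \<Longrightarrow> x \<sqsubseteq> x \<otimes> y"
    and le_left: "x \<in> carrier T \<Longrightarrow> y \<in> carrier T \<Longrightarrow> x \<sqsubseteq> y \<otimes> x"
begin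

abbreviation idem :: "nat \<Rightarrow> nat" where
  "idem x \<equiv> x [^] (fact (card (carrier T)) :: nat)"

text \<open>With e the idempotent power, e = e e = (e x) x^k lies above e x, which lies above
  e.\<close>

lemma idem_mult: "x \<in> carrier T \<Longrightarrow> idem x \<otimes> x = idem x"
proof (rule antisym)
  assume x: "x \<in> carrier T"
  obtain k where k: "(fact (card (carrier T)) :: nat) = Suc k"
    using fact_gt_zero[of "card (carrier T)", where 'a = nat] gr0_implies_Suc by blast
  have p: "idem x = x \<otimes> x [^] k"
    using x by (simp only: k nat_pow_Suc2)
  have "idem x = idem x \<otimes> idem x"
    using finite_monoid_power_fact(2)[OF monoid_axioms finite_carrier x order_refl] by simp
  also have "idem x \<otimes> idem x = (idem x \<otimes> x) \<otimes> x [^] k"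
    using x p by (simp add: m_assoc)
  finally show "idem x \<otimes> x \<sqsubseteq> idem x"
    using le_right[of "idem x \<otimes> x" "x [^] k"] x by simp
qed (use le_right in auto)

text \<open>With e the idempotent power of x y, the elements e, e x and e x y = e increase, so they
  are equal; dually on the left.\<close>

lemma idem_gamma:
  assumes "x \<in> carrier T" "y \<in> carrier T"
  shows "idem (x \<otimes> y) \<otimes> x = idem (x \<otimes> y)" "y \<otimes> idem (x \<otimes> y) = idem (x \<otimes> y)"
proof -
  let ?e = "idem (x \<otimes> y)"
  have e: "?e \<in> carrier T" "x \<otimes> y \<in> carrier T" using assms by auto
  have "?e \<otimes> x \<sqsubseteq> ?e"
    using le_right[of "?e \<otimes> x" y] idem_mult[OF e(2)] e assms by (simp add: m_assoc)
  then show "?e \<otimes> x = ?e"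
    using le_right e assms by (intro antisym) auto
  have "(x \<otimes> y) \<otimes> ?e = ?e"
    using idem_mult[OF e(2)] e nat_pow_comm[of "x \<otimes> y" 1] by simp
  then have "y \<otimes> ?e \<sqsubseteq> ?e"
    using le_left[of "y \<otimes> ?e" x] e assms by (simp add: m_assoc)
  then show "y \<otimes> ?e = ?e"
    using le_left e assms by (intro antisym) auto
qed

text \<open>Multiplying the idempotent power of y x by x on the left and y on the right moves it up,
  to the idempotent power of x y times x y, which is that power itself. Symmetry gives the
  converse.\<close>

lemma idem_swap:
  assumes "x \<in> carrier T" "y \<in> carrier T"
  shows "idem (x \<otimes> y) = idem (y \<otimes> x)"
proof -
  have *: "idem (y \<otimes> x) \<sqsubseteq> idem (x \<otimes> y)" if c: "x \<in> carrier T" "y \<in> carrier T" for x y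
  proof -
    have pow: "x \<otimes> (y \<otimes> x) [^] n \<otimes> y = (x \<otimes> y) [^] n \<otimes> (x \<otimes> y)" for n :: nat
    proof (induction n)
      case (Suc n)
      have "x \<otimes> (y \<otimes> x) [^] Suc n \<otimes> y = (x \<otimes> (y \<otimes> x) [^] n \<otimes> y) \<otimes> (x \<otimes> y)"
        using c by (simp add: m_assoc)
      then show ?case using Suc by simp
    qed (use c in simp)
    have a: "idem (y \<otimes> x) \<sqsubseteq> x \<otimes> idem (y \<otimes> x)"
      using c by (intro le_left) auto
    have b: "x \<otimes> idem (y \<otimes> x) \<sqsubseteq> x \<otimes> idem (y \<otimes> x) \<otimes> y"
      using c by (intro le_right) auto
    have "x \<otimes> idem (y \<otimes> x) \<otimes> y = idem (x \<otimes> y)"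
      using pow idem_mult c by simp
    then show ?thesis using le_trans[OF a b] by simp
  qed
  show ?thesis
    by (rule antisym[OF _ _ *[OF assms(2,1)] *[OF assms]]) (use assms in auto)
qed

lemma models_Sigma_Gamma: "models Sigma_ps T" "models Gamma_ps T"
proof -
  have T: "fin_mon T" using finite_carrier monoid_axioms by (simp add: fin_mon_def)
  have mult: "h (pmult B u v) = h u \<otimes> h v"
    if "cont_hom_fin B T h" "u \<in> pOmega B" "v \<in> pOmega B" for B :: "nat set" and h u v
    using that by (simp add: cont_hom_fin_def)
  have gen: "h (pgen B i) \<in> carrier T" if "cont_hom_fin B T h" "i \<in> B" for B :: "nat set" and h i
    using that by (auto simp: cont_hom_fin_def)
  have "h (pmult {0} (pomega {0} (pgen {0} 0)) (pgen {0} 0)) = h (pomega {0} (pgen {0} 0))"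
    if h: "cont_hom_fin {0} T h" for h :: "nat iop \<Rightarrow> nat"
    using mult[OF h] gen[OF h] cont_hom_fin_pomega[OF h T] idem_mult by simp
  moreover have "h (pomega {0,1} (pmult {0,1} (pgen {0,1} 0) (pgen {0,1} 1))) =
      h (pomega {0,1} (pmult {0,1} (pgen {0,1} 1) (pgen {0,1} 0)))"
    if h: "cont_hom_fin {0,1} T h" for h :: "nat iop \<Rightarrow> nat"
    using mult[OF h] gen[OF h] cont_hom_fin_pomega[OF h T] idem_swap by simp
  ultimately show "models Sigma_ps T"
    using T unfolding models_def Sigma_ps_def holds_in_def by blast
  let ?e = "pomega {0,1} (pmult {0,1} (pgen {0,1} 0) (pgen {0,1} 1)) :: nat iop"
  have "h (pmult {0,1} ?e (pgen {0,1} 0)) = h ?e" "h ?e = h (pmult {0,1} (pgen {0,1} 1) ?e)"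
    if h: "cont_hom_fin {0,1} T h" for h :: "nat iop \<Rightarrow> nat"
    using mult[OF h] gen[OF h] cont_hom_fin_pomega[OF h T] idem_gamma by simp_all
  then show "models Gamma_ps T"
    using T unfolding models_def Gamma_ps_def holds_in_def by blast
qed

end

lemma unit_least_subword_sets:
  assumes "finite A"
  shows "unit_least_monoid (nat_copy (subword_sets A k))
    (\<lambda>x y. nat_decode (subword_sets A k) x \<subseteq> nat_decode (subword_sets A k) y)"
proof -
  let ?M = "subword_sets A k"
  note fin = finite_subword_sets[OF assms, of k]
  have N: "monoid (nat_copy ?M)" "finite (carrier (nat_copy ?M))"
    using fin_mon_nat_copy[OF monoid_subword_sets fin] by (auto simp: fin_mon_def)
  have conc: "X \<subseteq> X \<otimes>\<^bsub>?M\<^esub> Y" "X \<subseteq> Y \<otimes>\<^bsub>?M\<^esub> X" if "X \<in> carrier ?M" "Y \<in> carrier ?M" for X Y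
  proof -
    have "x @ [] \<in> conc X Y" "[] @ x \<in> conc Y X" if "x \<in> X" for x
      using that \<open>Y \<in> carrier ?M\<close> by (auto simp: subword_sets_def intro: concI simp del: append_Nil append_Nil2)
    then show "X \<subseteq> X \<otimes>\<^bsub>?M\<^esub> Y" "X \<subseteq> Y \<otimes>\<^bsub>?M\<^esub> X"
      using \<open>X \<in> carrier ?M\<close> by (auto simp: subword_sets_def)
  qed
  interpret N: monoid "nat_copy ?M" by fact
  interpret M: monoid ?M by (rule monoid_subword_sets)
  show ?thesis
  proof
    fix x y assume "x \<in> carrier (nat_copy ?M)" "y \<in> carrier (nat_copy ?M)"
    then obtain X Y where XY: "X \<in> carrier ?M" "Y \<in> carrier ?M" "x = nat_code ?M X" "y = nat_code ?M Y"
      by (auto simp: nat_copy_sel)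
    have dec: "nat_decode ?M x = X" "nat_decode ?M y = Y"
      "nat_decode ?M (x \<otimes>\<^bsub>nat_copy ?M\<^esub> y) = X \<otimes>\<^bsub>?M\<^esub> Y"
      "nat_decode ?M (y \<otimes>\<^bsub>nat_copy ?M\<^esub> x) = Y \<otimes>\<^bsub>?M\<^esub> X"
      using XY fin by (simp_all add: nat_copy_sel)
    show "nat_decode ?M x \<subseteq> nat_decode ?M (x \<otimes>\<^bsub>nat_copy ?M\<^esub> y)"
      unfolding dec by (rule conc(1)[OF XY(1,2)])
    show "nat_decode ?M x \<subseteq> nat_decode ?M (y \<otimes>\<^bsub>nat_copy ?M\<^esub> x)"
      unfolding dec by (rule conc(2)[OF XY(1,2)])
    assume "nat_decode ?M x \<subseteq> nat_decode ?M y" "nat_decode ?M y \<subseteq> nat_decode ?M x"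
    then have "X = Y" unfolding dec by (rule subset_antisym)
    then show "x = y" using XY by simp
  qed (use N(2) in auto)
qed

text \<open>Evaluation at a fixed point is a continuous homomorphism, and membership of
  \<open>w\<close> is decided by one such evaluation into a model of both systems.\<close>

lemma valid_imp_subwords_eq:
  fixes A :: "'a set"
  assumes "finite A" "u \<in> pOmega A" "v \<in> pOmega A"
    and valid: "\<And>T. models Sigma_ps T \<Longrightarrow> models Gamma_ps T \<Longrightarrow> holds_in T A u v"
  shows "subwords A u = subwords A v"
proof (rule Set.set_eqI)
  fix w :: "'a list"
  let ?T = "nat_copy (subword_sets A (length w))" and ?e = "subword_gens A (length w)"
  note T = admissible_subword_sets[OF assms(1), of "length w"]
  interpret unit_least_monoid ?T
    "\<lambda>x y. nat_decode (subword_sets A (length w)) x \<subseteq> nat_decode (subword_sets A (length w)) y"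
    using assms(1) by (rule unit_least_subword_sets)
  have "cont_hom_fin A ?T (\<lambda>\<pi>. \<pi> ?T ?e)"
    unfolding cont_hom_fin_def
  proof (intro conjI ballI)
    show "\<exists>G. finite G \<and> (\<forall>x\<in>pOmega A. agree G y x \<longrightarrow> x ?T ?e = y ?T ?e)" for y :: "'a iop"
      by (rule exI[of _ "{(?T, ?e)}"]) (simp add: agree_def)
  qed (use T in \<open>auto simp: pmult_eval pone_eval pOmega_carrier\<close>)
  then have "u ?T ?e = v ?T ?e"
    using valid[OF models_Sigma_Gamma] unfolding holds_in_def by blast
  then show "w \<in> subwords A u \<longleftrightarrow> w \<in> subwords A v"
    by (simp add: subwords_def)
qed

section \<open>Provability\<close>

definition psubst :: "'b set \<Rightarrow> 'a set \<Rightarrow> ('b \<Rightarrow> 'a iop) \<Rightarrow> 'b iop \<Rightarrow> 'a iop" where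
  "psubst B A s \<pi> = (\<lambda>T e. if admissible A T e then \<pi> T (\<lambda>b\<in>B. s b T e) else undefined)"

lemma psubst_admissible:
  assumes "s \<in> B \<rightarrow> pOmega A" "admissible A T e"
  shows "admissible B T (\<lambda>b\<in>B. s b T e)"
  using assms pOmega_carrier[of _ A T e] by (auto simp: admissible_def)

lemma psubst_closed:
  assumes s: "s \<in> B \<rightarrow> pOmega A" and p: "\<pi> \<in> pOmega B"
  shows "psubst B A s \<pi> \<in> pOmega A"
proof (rule pOmegaI)
  fix T :: "nat monoid" and e
  show "\<not> admissible A T e \<Longrightarrow> psubst B A s \<pi> T e = undefined"
    by (simp add: psubst_def)
  show "admissible A T e \<Longrightarrow> psubst B A s \<pi> T e \<in> carrier T"
    using pOmega_carrier[OF p psubst_admissible[OF s]] by (simp add: psubst_def)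
next
  fix S T :: "nat monoid" and h e
  assume *: "admissible A S e" "fin_mon T" "h \<in> mon_hom S T" "admissible A T (\<lambda>a\<in>A. h (e a))"
  have "(\<lambda>b\<in>B. h ((\<lambda>b\<in>B. s b S e) b)) = (\<lambda>b\<in>B. s b T (\<lambda>a\<in>A. h (e a)))"
    using s pOmega_hom[OF _ *(1-3)] by (intro restrict_ext) auto
  then show "h (psubst B A s \<pi> S e) = psubst B A s \<pi> T (\<lambda>a\<in>A. h (e a))"
    using * pOmega_hom[OF p psubst_admissible[OF s *(1)] *(2,3)] by (simp add: psubst_def)
qed

lemma psubst_pmult:
  assumes "s \<in> B \<rightarrow> pOmega A"
  shows "psubst B A s (pmult B u v) = pmult A (psubst B A s u) (psubst B A s v)"
  using psubst_admissible[OF assms] by (auto simp: psubst_def pmult_def fun_eq_iff)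

lemma psubst_pone:
  assumes "s \<in> B \<rightarrow> pOmega A"
  shows "psubst B A s (pone B) = pone A"
  using psubst_admissible[OF assms] by (auto simp: psubst_def pone_def fun_eq_iff)

lemma psubst_pgen:
  assumes "s \<in> B \<rightarrow> pOmega A" "b \<in> B"
  shows "psubst B A s (pgen B b) = s b"
proof (rule pOmega_eqI[of _ A])
  show "psubst B A s (pgen B b) T e = s b T e" if "admissible A T e" for T e
    using psubst_admissible[OF assms(1) that] that assms(2) by (simp add: psubst_def pgen_eval)
qed (use assms psubst_closed[OF assms(1)] in auto)

lemma psubst_pomega:
  assumes s: "s \<in> B \<rightarrow> pOmega A" and x: "x \<in> pOmega B"
  shows "psubst B A s (pomega B x) = pomega A (psubst B A s x)"
proof (rule pOmega_eqI[of _ A])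
  fix T e assume T: "admissible A T e"
  show "psubst B A s (pomega B x) T e = pomega A (psubst B A s x) T e"
    using pomega_eval[OF x psubst_admissible[OF s T] order_refl]
      pomega_eval[OF psubst_closed[OF s x] T order_refl] T by (simp add: psubst_def)
qed (use psubst_closed[OF s] x in auto)

lemma cont_hom_psubst:
  fixes A :: "'a set" and B :: "'b set"
  assumes s: "s \<in> B \<rightarrow> pOmega A"
  shows "cont_hom B A (psubst B A s)"
  unfolding cont_hom_def
proof (intro conjI ballI allI impI)
  fix u :: "'b iop" and F :: "(nat monoid \<times> ('a \<Rightarrow> nat)) set" assume F: "finite F"
  show "\<exists>G. finite G \<and> (\<forall>w\<in>pOmega B. agree G u w \<longrightarrow> agree F (psubst B A s u) (psubst B A s w))"
    using F by (intro exI[of _ "(\<lambda>(T, e). (T, \<lambda>b\<in>B. s b T e)) ` F"])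
      (auto simp: agree_def psubst_def)
qed (use s psubst_closed psubst_pmult psubst_pone in auto)

section \<open>The base relation and its closure under contexts\<close>

definition instances :: "'a set \<Rightarrow> pseudoid set \<Rightarrow> ('a iop \<times> 'a iop) set" where
  "instances A \<Sigma> = {(\<phi> u, \<phi> v) | B u v \<phi>.
     ((B, u, v) \<in> \<Sigma> \<or> (B, v, u) \<in> \<Sigma>) \<and> cont_hom B A \<phi>}"

lemma instancesI:
  assumes "(B, u, v) \<in> \<Sigma> \<or> (B, v, u) \<in> \<Sigma>" "cont_hom B A \<phi>"
  shows "(\<phi> u, \<phi> v) \<in> instances A \<Sigma>"
  unfolding instances_def mem_Collect_eq
  by (rule exI[of _ B], rule exI[of _ u], rule exI[of _ v], rule exI[of _ \<phi>]) (use assms in simp)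

lemma instances_sym:
  assumes "(p, q) \<in> instances A \<Sigma>"
  shows "(q, p) \<in> instances A \<Sigma>"
  using assms[unfolded instances_def mem_Collect_eq prod.inject]
proof (elim exE conjE)
  fix B u v \<phi>
  assume *: "(B, u, v) \<in> \<Sigma> \<or> (B, v, u) \<in> \<Sigma>" "cont_hom B A \<phi>" "p = \<phi> u" "q = \<phi> v"
  from *(1) have "(B, v, u) \<in> \<Sigma> \<or> (B, u, v) \<in> \<Sigma>" by blast
  then show "(q, p) \<in> instances A \<Sigma>"
    unfolding *(3,4) using *(2) by (rule instancesI[of B v u \<Sigma> A \<phi>])
qed

lemma Sigma0_instances:
  "Sigma0 A \<Sigma> = {(meval A t (w(0 := p)), meval A t (w(0 := q))) | p q t w.
     (p, q) \<in> instances A \<Sigma> \<and> (\<forall>i. w i \<in> pOmega A)}"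
  (is "_ = ?R")
proof (intro equalityI subrelI)
  fix x y assume xy: "(x, y) \<in> Sigma0 A \<Sigma>"
  from xy[unfolded Sigma0_def mem_Collect_eq prod.inject] show "(x, y) \<in> ?R"
  proof (elim exE conjE)
    fix B u v \<phi> t w
    assume *: "(B, u, v) \<in> \<Sigma> \<or> (B, v, u) \<in> \<Sigma>" "cont_hom B A \<phi>" "\<forall>i. w i \<in> pOmega A"
      "x = meval A t (w(0 := \<phi> u))" "y = meval A t (w(0 := \<phi> v))"
    from *(1,2) have "(\<phi> u, \<phi> v) \<in> instances A \<Sigma>"
      by (rule instancesI[of B u v \<Sigma> A \<phi>])
    then show "(x, y) \<in> ?R" unfolding *(4,5) using *(3) by blast
  qed
next
  fix x y assume "(x, y) \<in> ?R"
  then obtain p q t w where *: "x = meval A t (w(0 := p))" "y = meval A t (w(0 := q))"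
    "(p, q) \<in> instances A \<Sigma>" "\<forall>i. w i \<in> pOmega A"
    by blast
  from *(3)[unfolded instances_def mem_Collect_eq prod.inject] show "(x, y) \<in> Sigma0 A \<Sigma>"
  proof (elim exE conjE)
    fix B u v \<phi>
    assume "(B, u, v) \<in> \<Sigma> \<or> (B, v, u) \<in> \<Sigma>" "cont_hom B A \<phi>" "p = \<phi> u" "q = \<phi> v"
    then show "(x, y) \<in> Sigma0 A \<Sigma>"
      unfolding Sigma0_def mem_Collect_eq using *(1,2,4)
      by - (rule exI[of _ B], rule exI[of _ u], rule exI[of _ v], rule exI[of _ \<phi>],
        rule exI[of _ t], rule exI[of _ w], simp)
  qed
qed

lemma Sigma0I:
  "(p, q) \<in> instances A \<Sigma> \<Longrightarrow> \<forall>i. w i \<in> pOmega A \<Longrightarrow>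
    (meval A t (w(0 := p)), meval A t (w(0 := q))) \<in> Sigma0 A \<Sigma>"
  unfolding Sigma0_instances by blast

lemma Sigma0E:
  assumes "(x, y) \<in> Sigma0 A \<Sigma>"
  obtains p q t w where "x = meval A t (w(0 := p))" "y = meval A t (w(0 := q))"
    "(p, q) \<in> instances A \<Sigma>" "\<forall>i. w i \<in> pOmega A"
  using assms unfolding Sigma0_instances by blast

lemma Sigma0_psubst:
  assumes "(B, u, v) \<in> \<Sigma> \<or> (B, v, u) \<in> \<Sigma>" "s \<in> B \<rightarrow> pOmega A"
  shows "(psubst B A s u, psubst B A s v) \<in> Sigma0 A \<Sigma>"
  using Sigma0I[OF instancesI[OF assms(1) cont_hom_psubst[OF assms(2)]], of "\<lambda>_. pone A" "MVar 0"]
  by simp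

primrec mvars :: "mterm \<Rightarrow> nat set" where
  "mvars (MVar i) = {i}"
| "mvars MOne = {}"
| "mvars (MMul s t) = mvars s \<union> mvars t"

lemma finite_mvars: "finite (mvars t)"
  by (induction t) auto

lemma meval_cong: "(\<And>i. i \<in> mvars t \<Longrightarrow> w i = w' i) \<Longrightarrow> meval A t w = meval A t w'"
  by (induction t) auto

lemma Sigma0_sym:
  assumes "(x, y) \<in> Sigma0 A \<Sigma>"
  shows "(y, x) \<in> Sigma0 A \<Sigma>"
  using assms by (rule Sigma0E) (simp add: Sigma0I instances_sym)

lemma Sigma0_pmult:
  assumes "(u, v) \<in> Sigma0 A \<Sigma>" "z \<in> pOmega A"
  shows "(pmult A z u, pmult A z v) \<in> Sigma0 A \<Sigma>" "(pmult A u z, pmult A v z) \<in> Sigma0 A \<Sigma>"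
proof -
  obtain p q t w where *: "u = meval A t (w(0 := p))" "v = meval A t (w(0 := q))"
    "(p, q) \<in> instances A \<Sigma>" "\<forall>i. w i \<in> pOmega A"
    using assms(1) by (rule Sigma0E)
  \<comment> \<open>The variable for the new factor \<open>z\<close> must also differ from 0, the
    slot that is overwritten by the instance.\<close>
  obtain k where k: "k \<notin> insert 0 (mvars t)"
    using ex_new_if_finite[OF infinite_UNIV_nat, of "insert 0 (mvars t)"] finite_mvars by blast
  define w' where "w' = w(k := z)"
  have ev: "meval A t (w'(0 := x)) = meval A t (w(0 := x))" "(w'(0 := x)) k = z" for x
    using k by (auto simp: w'_def intro: meval_cong)
  have w': "\<forall>i. w' i \<in> pOmega A" using *(4) assms(2) by (simp add: w'_def)
  show "(pmult A z u, pmult A z v) \<in> Sigma0 A \<Sigma>"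
    using Sigma0I[OF *(3) w', of "MMul (MVar k) t"] unfolding meval.simps ev *(1,2) .
  show "(pmult A u z, pmult A v z) \<in> Sigma0 A \<Sigma>"
    using Sigma0I[OF *(3) w', of "MMul t (MVar k)"] unfolding meval.simps ev *(1,2) .
qed

section \<open>Provability as a closed congruence\<close>

lemma provable_least:
  assumes "Sigma0 A \<Sigma> \<subseteq> R" "trans R" "pair_closure A R \<subseteq> R"
  shows "provable A \<Sigma> \<subseteq> R"
  unfolding provable_def using assms by blast

lemma Sigma0_provable: "Sigma0 A \<Sigma> \<subseteq> provable A \<Sigma>"
  unfolding provable_def by blast

lemma trans_provable: "trans (provable A \<Sigma>)"
  unfolding provable_def trans_def by blast

lemma pair_closure_mono: "R \<subseteq> S \<Longrightarrow> pair_closure A R \<subseteq> pair_closure A S"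
  unfolding pair_closure_def by fast

lemma pair_closure_provable: "pair_closure A (provable A \<Sigma>) \<subseteq> provable A \<Sigma>"
proof -
  have "pair_closure A (provable A \<Sigma>) \<subseteq> R"
    if R: "Sigma0 A \<Sigma> \<subseteq> R" "trans R" "pair_closure A R \<subseteq> R" for R
    using pair_closure_mono[OF provable_least[OF R], of A] R(3) by blast
  then show ?thesis by (subst (2) provable_def) (rule Inter_greatest, simp)
qed

text \<open>The preimage of \<open>provable\<close> under a map respecting agreement is again
  transitive and closed, so by minimality only the base relation has to be checked. It is used for
  multiplication by a fixed element.\<close>

lemma provable_invariant:
  assumes "(u, v) \<in> provable A \<Sigma>"
    and Sigma0: "\<And>u v. (u, v) \<in> Sigma0 A \<Sigma> \<Longrightarrow> (f u, f v) \<in> Sigma0 A \<Sigma>"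
    and closed: "\<And>u. u \<in> pOmega A \<Longrightarrow> f u \<in> pOmega A"
    and agree: "\<And>F u v. agree F u v \<Longrightarrow> agree F (f u) (f v)"
  shows "(f u, f v) \<in> provable A \<Sigma>"
proof -
  let ?R = "{(u, v). (f u, f v) \<in> provable A \<Sigma>}"
  have "pair_closure A ?R \<subseteq> ?R"
  proof (rule subrelI)
    fix u v assume uv: "(u, v) \<in> pair_closure A ?R"
    have "(f u, f v) \<in> pair_closure A (provable A \<Sigma>)"
      unfolding pair_closure_def mem_Collect_eq case_prod_conv
    proof (intro conjI allI impI)
      show "f u \<in> pOmega A" "f v \<in> pOmega A"
        using uv closed by (auto simp: pair_closure_def)
      fix F :: "(nat monoid \<times> ('a \<Rightarrow> nat)) set" assume "finite F"
      then obtain u' v' where "(u', v') \<in> ?R" "agree F u u'" "agree F v v'"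
        using uv unfolding pair_closure_def by blast
      then show "\<exists>(u', v')\<in>provable A \<Sigma>. agree F (f u) u' \<and> agree F (f v) v'"
        using agree by blast
    qed
    then show "(u, v) \<in> ?R" using pair_closure_provable by blast
  qed
  moreover have "trans ?R"
    using trans_provable[of A \<Sigma>] unfolding trans_def by blast
  moreover have "Sigma0 A \<Sigma> \<subseteq> ?R"
    using Sigma0 Sigma0_provable by blast
  ultimately show ?thesis
    using provable_least[of A \<Sigma> ?R] assms(1) by blast
qed

text \<open>The base relation uses each pseudoidentity in both directions, and reversing pairs
  preserves transitivity and closedness.\<close>

lemma provable_sym:
  assumes "(u, v) \<in> provable A \<Sigma>"
  shows "(v, u) \<in> provable A \<Sigma>"
proof -
  let ?R = "{(u, v). (v, u) \<in> provable A \<Sigma>}"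
  have "Sigma0 A \<Sigma> \<subseteq> ?R"
    using Sigma0_sym Sigma0_provable by fast
  moreover have "trans ?R"
    using trans_provable[of A \<Sigma>] unfolding trans_def by blast
  moreover have "pair_closure A ?R \<subseteq> ?R"
  proof (rule subrelI)
    fix u v assume "(u, v) \<in> pair_closure A ?R"
    then have "(v, u) \<in> pair_closure A (provable A \<Sigma>)"
      unfolding pair_closure_def by fast
    then show "(u, v) \<in> ?R" using pair_closure_provable by blast
  qed
  ultimately show ?thesis
    using provable_least[of A \<Sigma> ?R] assms by blast
qed

text \<open>Any instance put into the term \<open>MVar 1\<close>, which ignores the slot 0, gives
  the pair \<open>(u, u)\<close>; a member of the system together with the trivial substitution
  supplies the instance.\<close>

lemma provable_refl:
  assumes "\<Sigma> \<noteq> {}" "u \<in> pOmega A"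
  shows "(u, u) \<in> provable A \<Sigma>"
proof -
  obtain B p q where "(B, p, q) \<in> \<Sigma>" using assms(1) by auto
  moreover have "cont_hom B A (psubst B A (\<lambda>_. pone A))"
    by (rule cont_hom_psubst) auto
  ultimately have "(u, u) \<in> Sigma0 A \<Sigma>"
    using Sigma0I[OF instancesI, of B p q \<Sigma> A _ "\<lambda>_. u" "MVar 1"] assms(2) by simp
  then show ?thesis using Sigma0_provable by blast
qed

lemma closed_congruence_provable:
  assumes "finite A" "\<Sigma> \<noteq> {}"
  shows "closed_congruence A (\<lambda>u v. (u, v) \<in> provable A \<Sigma>)"
proof
  show "(u, w) \<in> provable A \<Sigma>" if "(u, v) \<in> provable A \<Sigma>" "(v, w) \<in> provable A \<Sigma>" for u v w
    using trans_provable that by (rule transD)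
  show "(pmult A w u, pmult A w v) \<in> provable A \<Sigma>"
    if "(u, v) \<in> provable A \<Sigma>" "w \<in> pOmega A" for u v w
    by (rule provable_invariant[OF that(1)]) (use that(2) Sigma0_pmult in \<open>auto intro: agree_pmult\<close>)
  show "(pmult A u w, pmult A v w) \<in> provable A \<Sigma>"
    if "(u, v) \<in> provable A \<Sigma>" "w \<in> pOmega A" for u v w
    by (rule provable_invariant[OF that(1), of "\<lambda>u. pmult A u w"])
      (use that(2) Sigma0_pmult in \<open>auto intro: agree_pmult\<close>)
  show "pair_closure A {(u, v). (u, v) \<in> provable A \<Sigma>} \<subseteq> {(u, v). (u, v) \<in> provable A \<Sigma>}"
    using pair_closure_provable by simp
  show "(u, u) \<in> provable A \<Sigma>" if "u \<in> pOmega A" for u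
    using assms(2) that by (rule provable_refl)
qed (fact assms(1), fact provable_sym)

section \<open>The two systems as Gamma congruences\<close>

definition two_letters :: "'a iop \<Rightarrow> 'a iop \<Rightarrow> nat \<Rightarrow> 'a iop" where
  "two_letters x y = (\<lambda>i. if i = 0 then x else y)"

lemma psubst_two_letters:
  assumes "x \<in> pOmega A" "y \<in> pOmega A"
  shows "psubst {0, 1} A (two_letters x y) (pgen {0, 1} 0) = x"
    and "psubst {0, 1} A (two_letters x y) (pgen {0, 1} 1) = y"
proof -
  have "two_letters x y \<in> {0, 1} \<rightarrow> pOmega A"
    using assms by (simp add: two_letters_def)
  from psubst_pgen[OF this, of 0] psubst_pgen[OF this, of 1]
  show "psubst {0, 1} A (two_letters x y) (pgen {0, 1} 0) = x"
    "psubst {0, 1} A (two_letters x y) (pgen {0, 1} 1) = y"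
    by (simp_all add: two_letters_def)
qed

lemma gamma_congruence_Gamma:
  fixes A :: "'a set"
  assumes "finite A"
  shows "gamma_congruence A (\<lambda>u v. (u, v) \<in> provable A Gamma_ps)"
proof -
  interpret closed_congruence A "\<lambda>u v. (u, v) \<in> provable A Gamma_ps"
    by (rule closed_congruence_provable) (use assms in \<open>auto simp: Gamma_ps_def\<close>)
  show ?thesis
  proof
    fix x y :: "'a iop" assume xy: "x \<in> pOmega A" "y \<in> pOmega A"
    let ?B = "{0, 1} :: nat set" and ?s = "two_letters x y"
    have s: "?s \<in> ?B \<rightarrow> pOmega A" using xy by (auto simp: two_letters_def)
    note ps = psubst_pmult[OF s] psubst_pomega[OF s] psubst_two_letters[OF xy]
    let ?e = "pomega ?B (pmult ?B (pgen ?B 0) (pgen ?B 1))"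
    have "(psubst ?B A ?s (pmult ?B ?e (pgen ?B 0)), psubst ?B A ?s ?e) \<in> Sigma0 A Gamma_ps"
      by (rule Sigma0_psubst) (use s in \<open>auto simp: Gamma_ps_def\<close>)
    then show "(pmult A (pomega A (pmult A x y)) x, pomega A (pmult A x y)) \<in> provable A Gamma_ps"
      using subsetD[OF Sigma0_provable] by (simp add: ps del: One_nat_def)
    have "(psubst ?B A ?s (pmult ?B (pgen ?B 1) ?e), psubst ?B A ?s ?e) \<in> Sigma0 A Gamma_ps"
      by (rule Sigma0_psubst) (use s in \<open>auto simp: Gamma_ps_def\<close>)
    then show "(pmult A y (pomega A (pmult A x y)), pomega A (pmult A x y)) \<in> provable A Gamma_ps"
      using subsetD[OF Sigma0_provable] by (simp add: ps del: One_nat_def)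
  qed
qed

text \<open>Writing \<open>e\<close> for \<open>(xy)\<^sup>\<omega>\<close>, the equation \<open>e = (yx)\<^sup>\<omega>\<close> makes \<open>e\<close>
commute with \<open>x\<close>; then \<open>e = exy\<close> iterates to \<open>e = e x\<^sup>n y\<^sup>n\<close>, in the limit
\<open>e = e x\<^sup>\<omega> y\<^sup>\<omega>\<close>, and \<open>x\<close> is absorbed by \<open>x\<^sup>\<omega>\<close>.\<close>

lemma (in closed_congruence) gamma_congruence_if_Sigma:
  assumes aperiodic: "\<And>x. x \<in> pOmega A \<Longrightarrow> pomega A x \<cdot> x \<approx> pomega A x"
    and swap: "\<And>x y. x \<in> pOmega A \<Longrightarrow> y \<in> pOmega A \<Longrightarrow> pomega A (x \<cdot> y) \<approx> pomega A (y \<cdot> x)"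
  shows "gamma_congruence A (\<approx>)"
proof
  fix x y assume x: "x \<in> pOmega A" and y: "y \<in> pOmega A"
  define e where "e = pomega A (x \<cdot> y)"
  have e: "e \<in> pOmega A" using x y by (simp add: e_def)
  have comm: "x \<cdot> e \<approx> e \<cdot> x"
  proof -
    have "x \<cdot> e \<approx> x \<cdot> pomega A (y \<cdot> x)"
      unfolding e_def using x y swap by (intro eqv_left)
    also have "x \<cdot> pomega A (y \<cdot> x) = e \<cdot> x"
      unfolding e_def using x y by (rule pmult_pomega_commute)
    finally show ?thesis .
  qed
  have comm_y: "y \<cdot> e \<approx> e \<cdot> y"
  proof -
    have "y \<cdot> e = pomega A (y \<cdot> x) \<cdot> y"
      unfolding e_def using y x by (rule pmult_pomega_commute)
    also have "pomega A (y \<cdot> x) \<cdot> y \<approx> e \<cdot> y"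
      unfolding e_def using x y swap by (intro eqv_right)
    finally show ?thesis .
  qed
  have exy: "e \<cdot> x \<cdot> y \<approx> e"
    using aperiodic[of "x \<cdot> y"] x y e by (simp add: e_def pmult_assoc)
  have pow: "e \<cdot> ppow A x n \<cdot> ppow A y n \<approx> e" for n
  proof (induction n)
    case 0
    then show ?case using e eqv_refl by simp
  next
    case (Suc n)
    have px: "ppow A x n \<cdot> x = x \<cdot> ppow A x n" for n
      by (induction n) (use x in \<open>simp_all add: pmult_assoc\<close>)
    \<comment> \<open>The new \<open>x\<close> is moved to the left of \<open>e\<close>, so that the
      induction hypothesis applies between it and the new \<open>y\<close>; then it is moved
      back.\<close>
    have "e \<cdot> ppow A x (Suc n) \<cdot> ppow A y (Suc n) = e \<cdot> x \<cdot> (ppow A x n \<cdot> (ppow A y n \<cdot> y))"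
      using x y e by (simp add: px pmult_assoc)
    also have "\<dots> \<approx> x \<cdot> e \<cdot> (ppow A x n \<cdot> (ppow A y n \<cdot> y))"
      using x y by (intro eqv_right eqv_sym[OF comm]) auto
    also have "x \<cdot> e \<cdot> (ppow A x n \<cdot> (ppow A y n \<cdot> y)) = x \<cdot> (e \<cdot> ppow A x n \<cdot> ppow A y n) \<cdot> y"
      using x y e by (simp add: pmult_assoc)
    also have "\<dots> \<approx> x \<cdot> e \<cdot> y"
      using x y Suc by (intro eqv_right eqv_left)
    also have "x \<cdot> e \<cdot> y \<approx> e \<cdot> x \<cdot> y"
      using y comm by (intro eqv_right)
    also have "e \<cdot> x \<cdot> y \<approx> e" by fact
    finally show ?case .
  qed
  have lim: "e \<cdot> pomega A x \<cdot> pomega A y \<approx> e"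
  proof (rule eqv_limit)
    fix F :: "(nat monoid \<times> ('a \<Rightarrow> nat)) set" assume "finite F"
    then obtain n where n: "agree F (ppow A x (fact n)) (pomega A x)"
      "agree F (ppow A y (fact n)) (pomega A y)"
      using pomega_agree2[OF x y] by blast
    then have "agree F (e \<cdot> pomega A x \<cdot> pomega A y) (e \<cdot> ppow A x (fact n) \<cdot> ppow A y (fact n))"
      by (simp add: agree_pmult agree_sym)
    then show "\<exists>u' v'. u' \<approx> v' \<and> agree F (e \<cdot> pomega A x \<cdot> pomega A y) u' \<and> agree F e v'"
      using pow agree_refl by blast
  qed (use e x y in auto)
  have ex: "e \<cdot> x \<approx> e"
  proof -
    have "e \<cdot> x \<approx> x \<cdot> e" using comm by (rule eqv_sym)
    also have "x \<cdot> e \<approx> x \<cdot> (e \<cdot> pomega A x \<cdot> pomega A y)"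
      using x lim by (intro eqv_left eqv_sym[OF lim])
    also have "x \<cdot> (e \<cdot> pomega A x \<cdot> pomega A y) = x \<cdot> e \<cdot> (pomega A x \<cdot> pomega A y)"
      using x y e by (simp add: pmult_assoc)
    also have "\<dots> \<approx> e \<cdot> x \<cdot> (pomega A x \<cdot> pomega A y)"
      using x y comm by (intro eqv_right) auto
    also have "e \<cdot> x \<cdot> (pomega A x \<cdot> pomega A y) = e \<cdot> (x \<cdot> pomega A x) \<cdot> pomega A y"
      using x y e by (simp add: pmult_assoc)
    also have "x \<cdot> pomega A x = pomega A x \<cdot> x"
      using pmult_pomega_commute[of x A "pone A"] x by simp
    also have "e \<cdot> (pomega A x \<cdot> x) \<cdot> pomega A y \<approx> e \<cdot> pomega A x \<cdot> pomega A y"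
      using x y e aperiodic by (intro eqv_right eqv_left) auto
    also have "e \<cdot> pomega A x \<cdot> pomega A y \<approx> e" by fact
    finally show ?thesis .
  qed
  \<comment> \<open>Left absorption of \<open>y\<close> follows from right absorption of
    \<open>x\<close>: y e = e y = e x y = e.\<close>
  have "y \<cdot> e \<approx> e \<cdot> y" by fact
  also have "e \<cdot> y \<approx> e \<cdot> x \<cdot> y"
    using y ex by (intro eqv_right eqv_sym[OF ex])
  also have "e \<cdot> x \<cdot> y \<approx> e" by fact
  finally have ye: "y \<cdot> e \<approx> e" .
  show "pomega A (x \<cdot> y) \<cdot> x \<approx> pomega A (x \<cdot> y)" "y \<cdot> pomega A (x \<cdot> y) \<approx> pomega A (x \<cdot> y)"
    using ex ye by (simp_all add: e_def)
qed

lemma gamma_congruence_Sigma: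
  fixes A :: "'a set"
  assumes "finite A"
  shows "gamma_congruence A (\<lambda>u v. (u, v) \<in> provable A Sigma_ps)"
proof -
  interpret closed_congruence A "\<lambda>u v. (u, v) \<in> provable A Sigma_ps"
    by (rule closed_congruence_provable) (use assms in \<open>auto simp: Sigma_ps_def\<close>)
  show ?thesis
  proof (rule gamma_congruence_if_Sigma)
    fix x :: "'a iop" assume x: "x \<in> pOmega A"
    let ?B = "{0} :: nat set" and ?s = "\<lambda>_::nat. x"
    have s: "?s \<in> ?B \<rightarrow> pOmega A" using x by simp
    note ps = psubst_pmult[OF s] psubst_pomega[OF s] psubst_pgen[OF s]
    have "(psubst ?B A ?s (pmult ?B (pomega ?B (pgen ?B 0)) (pgen ?B 0)),
        psubst ?B A ?s (pomega ?B (pgen ?B 0))) \<in> Sigma0 A Sigma_ps"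
      by (rule Sigma0_psubst) (use s in \<open>auto simp: Sigma_ps_def\<close>)
    then show "(pmult A (pomega A x) x, pomega A x) \<in> provable A Sigma_ps"
      using subsetD[OF Sigma0_provable] by (simp add: ps)
  next
    fix x y :: "'a iop" assume xy: "x \<in> pOmega A" "y \<in> pOmega A"
    let ?B = "{0, 1} :: nat set" and ?s = "two_letters x y"
    have s: "?s \<in> ?B \<rightarrow> pOmega A" using xy by (auto simp: two_letters_def)
    note ps = psubst_pmult[OF s] psubst_pomega[OF s] psubst_two_letters[OF xy]
    have "(psubst ?B A ?s (pomega ?B (pmult ?B (pgen ?B 0) (pgen ?B 1))),
        psubst ?B A ?s (pomega ?B (pmult ?B (pgen ?B 1) (pgen ?B 0)))) \<in> Sigma0 A Sigma_ps"
      by (rule Sigma0_psubst) (use s in \<open>auto simp: Sigma_ps_def\<close>)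
    then show "(pomega A (pmult A x y), pomega A (pmult A y x)) \<in> provable A Sigma_ps"
      using subsetD[OF Sigma0_provable] by (simp add: ps del: One_nat_def)
  qed
qed

theorem theorem7p7:
  fixes A :: "'a set"
  assumes "finite A"
  shows "h_strong_on A Sigma_ps \<and> h_strong_on A Gamma_ps"
proof
  interpret S: gamma_congruence A "\<lambda>u v. (u, v) \<in> provable A Sigma_ps"
    using assms by (rule gamma_congruence_Sigma)
  show "h_strong_on A Sigma_ps"
    unfolding h_strong_on_def
    using S.subwords_eq_imp_eqv valid_imp_subwords_eq[OF assms] by blast
  interpret G: gamma_congruence A "\<lambda>u v. (u, v) \<in> provable A Gamma_ps"
    using assms by (rule gamma_congruence_Gamma)
  show "h_strong_on A Gamma_ps"
    unfolding h_strong_on_def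
    using G.subwords_eq_imp_eqv valid_imp_subwords_eq[OF assms] by blast
qed

end
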